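(* Consider the coupled stochastic approximation scheme described in the context. Suppose: (A1-2) for every $\theta\in\Theta$, $f(\cdot;\theta)$ is convex and continuously differentiable on $X$ with $L_x$-Lipschitz gradient in $x$; for every $x\in X$, $\nabla_x f(x;\theta)$ is Lipschitz continuous in $\theta$ with constant $L_\theta$; $g$ is strongly convex on $\Theta$ with constant $\mu_\theta>0$ and continuously differentiable with $C_\theta$-Lipschitz gradient; (A2-2) for some $\tau\in(0,1)$: $\sum_k\gamma_{k,x}^{2-\tau}<\infty$, $\sum_k\gamma_{k,\theta}^2<\infty$, $\sum_k\gamma_{k,x}=\infty$, $\sum_k\gamma_{k,\theta}=\infty$, and $\beta_k:=\frac{\gamma_{k,x}^\tau}{2\gamma_{k,\theta}\mu_\theta}$ is nonincreasing with $\beta_k\downarrow0$ as $k\to\infty$; (A3) almost surely for all $k$: $\mathbb{E}[w^k\mid\mathcal{F}_k]=0$, $\mathbb{E}[v^k\mid\mathcal{F}_k]=0$, $\mathbb{E}[\|w^k\|^2\mid\mathcal{F}_k]\le\nu_x^2$, $\mathbb{E}[\|v^k\|^2\mid\mathcal{F}_k]\le\nu_\theta^2$. Suppose moreover that $X$ is bounded and the solution set $X^*$ of $\min_{x\in X}f(x;\theta^* )$ is nonempty, where $\theta^*$ is the unique minimizer of $g$ over $\Theta$. Then $\theta^k\to\theta^*$ almost surely, and $x^k$ converges almost surely to a (random) point of $X^*$.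
   Context: $X\subseteq\mathbb{R}^n$, $\Theta\subseteq\mathbb{R}^m$ are nonempty closed convex sets; $\xi$ is a random vector on $(\Omega,\mathcal{F}_x,\mathbb{P}_x)$ and $\eta$ on $(\Lambda,\mathcal{F}_\theta,\mathbb{P}_\theta)$, working on the product space. $f(x;\theta):=\mathbb{E}[f(x;\theta,\xi)]$, $g(\theta):=\mathbb{E}[g(\theta;\eta)]$. $\Pi_K$ is the Euclidean projection onto $K$. Coupled scheme: given $x^0\in X$, $\theta^0\in\Theta$ and positive steplengths $\gamma_{k,x},\gamma_{k,\theta}$, for $k\ge0$: $x^{k+1}=\Pi_X\big(x^k-\gamma_{k,x}(\nabla_x f(x^k;\theta^k)+w^k)\big)$, $\theta^{k+1}=\Pi_\Theta\big(\theta^k-\gamma_{k,\theta}(\nabla_\theta g(\theta^k)+v^k)\big)$, with $w^k=\nabla_x f(x^k;\theta^k,\xi^k)-\nabla_x f(x^k;\theta^k)$, $v^k=\nabla_\theta g(\theta^k;\eta^k)-\nabla_\theta g(\theta^k)$. $\mathcal{F}_k$ is the $\sigma$-field generated by $(x^0,\theta^0)$ and $(w^l,v^l)$, $l<k$. *)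

theory Defs
  imports "HOL-Probability.Probability"
begin

definition strongly_convex_on :: "'a::real_normed_vector set \<Rightarrow> real \<Rightarrow> ('a \<Rightarrow> real) \<Rightarrow> bool" where
  "strongly_convex_on S mu g \<longleftrightarrow>
     (\<forall>x\<in>S. \<forall>y\<in>S. \<forall>t::real. 0 \<le> t \<and> t \<le> 1 \<longrightarrow>
        g ((1 - t) *\<^sub>R x + t *\<^sub>R y) \<le> (1 - t) * g x + t * g y - mu / 2 * t * (1 - t) * (norm (x - y))\<^sup>2)"

definition rv_events :: "'a measure \<Rightarrow> ('a \<Rightarrow> 'b::topological_space) \<Rightarrow> 'a set set" where
  "rv_events M Z = {Z -` A \<inter> space M | A. A \<in> sets borel}"

definition gen_filtration ::
  "'a measure \<Rightarrow> ('a \<Rightarrow> 'x::topological_space) \<Rightarrow> ('a \<Rightarrow> 't::topological_space)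
    \<Rightarrow> (nat \<Rightarrow> 'a \<Rightarrow> 'x) \<Rightarrow> (nat \<Rightarrow> 'a \<Rightarrow> 't) \<Rightarrow> nat \<Rightarrow> 'a measure" where
  "gen_filtration M x0 th0 w v k =
     sigma (space M) (rv_events M x0 \<union> rv_events M th0 \<union>
                      (\<Union>l<k. rv_events M (w l) \<union> rv_events M (v l)))"

end

theory Submission
  imports Defs
begin

text \<open>Both recursions are handled pathwise. Nonexpansiveness of the projection gives an inequality
  \<open>u (k + 1) \<le> u k - b k + c k\<close> for the squared distance to a solution, where \<open>b \<ge> 0\<close> and \<open>c\<close>
  collects the noise; once \<open>\<Sum> c k\<close> converges, \<open>u\<close> converges and \<open>\<Sum> b k\<close> is finite. Convergence of the noise
  series follows from the almost sure convergence of martingales bounded in \<open>L\<^sup>2\<close>. For \<open>\<theta>\<close> this yields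
  \<open>\<theta> k \<longlonglongrightarrow> \<theta>*\<close> together with \<open>\<Sum> \<gamma>\<theta> k \<parallel>\<theta> k - \<theta>*\<parallel>\<^sup>2 < \<infinity>\<close>; by AM-GM and the boundedness of
  \<open>\<gamma>x k powr \<tau> / \<gamma>\<theta> k\<close> the latter makes the gradient error \<open>\<gamma>x k \<parallel>\<theta> k - \<theta>*\<parallel>\<close> summable, so \<open>x\<close> follows an
  inexact projected gradient method for \<open>f \<cdot> \<theta>*\<close>. Its noise enters only through the series of
  \<open>\<gamma>x k *\<^sub>R w k\<close> and of \<open>\<gamma>x k * (x k \<bullet> w k)\<close>, hence a single null set serves for the distances to all
  solutions at once, in particular to a random cluster point of \<open>x\<close>.\<close>

section \<open>Projected gradient steps and perturbed descent\<close>

text \<open>The projection is nonexpansive and fixes \<open>y\<close>, so the projected step is no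
  farther from \<open>y\<close> than the unprojected one, whose square is expanded. Drift
  \<open>d\<close> and noise \<open>e\<close> stay separate in the linear part, because the noise
  part will be summed as a martingale.\<close>

lemma closest_point_step:
  fixes S :: "'a::euclidean_space set"
  assumes "closed S" "convex S" "y \<in> S"
  shows "(norm (closest_point S (x - \<gamma> *\<^sub>R (d + e)) - y))\<^sup>2
    \<le> (norm (x - y))\<^sup>2 - 2 * \<gamma> * (d \<bullet> (x - y)) - 2 * \<gamma> * (e \<bullet> (x - y))
      + 2 * \<gamma>\<^sup>2 * ((norm d)\<^sup>2 + (norm e)\<^sup>2)"
proof -
  have "dist (closest_point S (x - \<gamma> *\<^sub>R (d + e))) (closest_point S y) \<le> dist (x - \<gamma> *\<^sub>R (d + e)) y"
    using assms by (intro closest_point_lipschitz) auto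
  then have "norm (closest_point S (x - \<gamma> *\<^sub>R (d + e)) - y) \<le> norm ((x - y) - \<gamma> *\<^sub>R (d + e))"
    using closest_point_self[OF \<open>y \<in> S\<close>] by (simp add: dist_norm algebra_simps)
  then have "(norm (closest_point S (x - \<gamma> *\<^sub>R (d + e)) - y))\<^sup>2 \<le> (norm ((x - y) - \<gamma> *\<^sub>R (d + e)))\<^sup>2"
    by (intro power_mono) auto
  also have "\<dots> = (norm (x - y))\<^sup>2 - 2 * \<gamma> * (d \<bullet> (x - y)) - 2 * \<gamma> * (e \<bullet> (x - y)) + \<gamma>\<^sup>2 * (norm (d + e))\<^sup>2"
    unfolding power2_norm_eq_inner by (simp add: inner_diff inner_add inner_commute power2_eq_square algebra_simps)
  also have "(norm (d + e))\<^sup>2 \<le> 2 * ((norm d)\<^sup>2 + (norm e)\<^sup>2)"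
    using inner_ge_zero[of "d - e"] unfolding power2_norm_eq_inner
    by (simp add: inner_diff inner_add inner_commute algebra_simps)
  then have "\<gamma>\<^sup>2 * (norm (d + e))\<^sup>2 \<le> 2 * \<gamma>\<^sup>2 * ((norm d)\<^sup>2 + (norm e)\<^sup>2)"
    using mult_left_mono[of "(norm (d + e))\<^sup>2" "2 * ((norm d)\<^sup>2 + (norm e)\<^sup>2)" "\<gamma>\<^sup>2"]
    by (simp add: algebra_simps)
  finally show ?thesis by simp
qed

text \<open>The convexity inequality on the segment from \<open>x\<close> to \<open>y\<close> is
  divided by \<open>t\<close>, and \<open>t\<close> tends to 0 from the right. Modulus 0 gives the
  gradient inequality of plain convexity.\<close>

lemma strongly_convex_on_gradient_le:
  fixes g :: "'a::real_inner \<Rightarrow> real"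
  assumes g: "strongly_convex_on S \<mu> g" and d: "(g has_derivative (\<lambda>h. d \<bullet> h)) (at x)"
    and xy: "x \<in> S" "y \<in> S"
  shows "g x + d \<bullet> (y - x) + \<mu> / 2 * (norm (x - y))\<^sup>2 \<le> g y"
proof -
  define \<phi> where "\<phi> t = g (x + t *\<^sub>R (y - x))" for t
  have "(\<phi> has_derivative (\<lambda>t. d \<bullet> (t *\<^sub>R (y - x)))) (at 0)"
    unfolding \<phi>_def
    by (rule has_derivative_compose[where g = g and f = "\<lambda>t. x + t *\<^sub>R (y - x)", simplified])
       (use d in \<open>auto intro!: derivative_eq_intros\<close>)
  then have "(\<phi> has_real_derivative (d \<bullet> (y - x))) (at 0)"
    by (simp add: has_field_derivative_def mult.commute[of "d \<bullet> (y - x)"] mult_commute_abs)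
  then have "((\<lambda>t. (\<phi> t - \<phi> 0) / t) \<longlongrightarrow> d \<bullet> (y - x)) (at_right 0)"
    unfolding DERIV_def by (auto intro: tendsto_within_subset)
  moreover have "((\<lambda>t. g y - g x - \<mu> / 2 * (1 - t) * (norm (x - y))\<^sup>2)
      \<longlongrightarrow> g y - g x - \<mu> / 2 * (1 - 0) * (norm (x - y))\<^sup>2) (at_right 0)"
    by (intro tendsto_intros)
  moreover have "\<forall>\<^sub>F t in at_right (0::real). (\<phi> t - \<phi> 0) / t
      \<le> g y - g x - \<mu> / 2 * (1 - t) * (norm (x - y))\<^sup>2"
    using eventually_at_right_real[of 0 1]
  proof (rule eventually_mono)
    fix t :: real assume "t \<in> {0<..<1}"
    then have t: "0 < t" "t < 1" by auto
    have "x + t *\<^sub>R (y - x) = (1 - t) *\<^sub>R x + t *\<^sub>R y" by (simp add: algebra_simps)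
    then have "\<phi> t \<le> (1 - t) * g x + t * g y - \<mu> / 2 * t * (1 - t) * (norm (x - y))\<^sup>2"
      using g xy t unfolding strongly_convex_on_def \<phi>_def by auto
    also have "\<dots> = \<phi> 0 + t * (g y - g x - \<mu> / 2 * (1 - t) * (norm (x - y))\<^sup>2)"
      by (simp add: \<phi>_def algebra_simps)
    finally show "(\<phi> t - \<phi> 0) / t \<le> g y - g x - \<mu> / 2 * (1 - t) * (norm (x - y))\<^sup>2"
      using t by (simp add: field_simps)
  qed simp
  ultimately have "d \<bullet> (y - x) \<le> g y - g x - \<mu> / 2 * (1 - 0) * (norm (x - y))\<^sup>2"
    by (intro tendsto_le[of "at_right (0::real)"]) auto
  then show ?thesis by simp
qed

lemma convex_on_gradient_le:
  fixes \<phi> :: "'a::real_inner \<Rightarrow> real"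
  assumes "convex_on S \<phi>" "(\<phi> has_derivative (\<lambda>h. d \<bullet> h)) (at x)" "x \<in> S" "y \<in> S"
  shows "\<phi> x + d \<bullet> (y - x) \<le> \<phi> y"
proof -
  have "strongly_convex_on S 0 \<phi>"
    using assms(1) by (auto simp: strongly_convex_on_def intro: convex_onD)
  from strongly_convex_on_gradient_le[OF this assms(2-4)] show ?thesis by simp
qed

text \<open>A discrete Gronwall bound: since \<open>1 + p k \<le> exp (p k)\<close>, the accumulated
  factors never exceed \<open>exp (suminf p)\<close>. It will bound expected squared distances
  uniformly in time.\<close>

lemma perturbed_recursion_bounded:
  fixes a p q :: "nat \<Rightarrow> real"
  assumes step: "\<And>k. a (Suc k) \<le> (1 + p k) * a k + q k"
    and nn: "\<And>k. 0 \<le> a k" "\<And>k. 0 \<le> p k" "\<And>k. 0 \<le> q k" and sm: "summable p" "summable q"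
  obtains K where "\<And>k. a k \<le> K"
proof -
  have *: "a n \<le> exp (\<Sum>k<n. p k) * (a 0 + (\<Sum>k<n. q k))" for n
  proof (induction n)
    case (Suc n)
    let ?P = "\<Sum>k<n. p k" and ?Q = "a 0 + (\<Sum>k<n. q k)"
    have Q: "0 \<le> ?Q" using nn by (simp add: sum_nonneg)
    have "a (Suc n) \<le> (1 + p n) * a n + q n" by (rule step)
    \<comment> \<open>\<open>q n\<close> is inflated by a factor at least 1, so that the same
      exponential can be pulled out of both terms.\<close>
    also have "\<dots> \<le> exp (p n) * (exp ?P * ?Q) + exp (?P + p n) * q n"
    proof (intro add_mono mult_mono)
      have "1 \<le> exp (?P + p n)" using nn by (simp add: sum_nonneg)
      then show "q n \<le> exp (?P + p n) * q n" using nn(3)[of n] by (simp add: mult_le_cancel_right1)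
    qed (use nn Suc in auto)
    finally show ?case by (simp add: exp_add algebra_simps)
  qed simp
  have "a n \<le> exp (suminf p) * (a 0 + suminf q)" for n
  proof (rule order_trans[OF *], rule mult_mono)
    show "exp (\<Sum>k<n. p k) \<le> exp (suminf p)" using sm nn by (simp add: sum_le_suminf)
    show "a 0 + (\<Sum>k<n. q k) \<le> a 0 + suminf q" using sm nn by (simp add: sum_le_suminf)
  qed (use nn in \<open>auto intro!: add_nonneg_nonneg sum_nonneg\<close>)
  then show ?thesis using that by blast
qed

text \<open>A pathwise counterpart of the Robbins-Siegmund theorem. The terms of \<open>c\<close>
  may change sign and their series may converge only conditionally: subtracting the partial sums of
  \<open>c\<close> from \<open>u\<close> leaves a decreasing sequence bounded below, and telescoping
  bounds the partial sums of \<open>b\<close>.\<close>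

lemma perturbed_descent:
  fixes u b c :: "nat \<Rightarrow> real"
  assumes step: "\<And>k. u (Suc k) \<le> u k - b k + c k"
    and nn: "\<And>k. 0 \<le> u k" "\<And>k. 0 \<le> b k" and c: "summable c"
  shows "convergent u" "summable b"
proof -
  define C where "C n = (\<Sum>k<n. c k)" for n
  have conv: "convergent C" using c unfolding C_def by (simp add: summable_iff_convergent)
  then obtain K where K: "\<And>n. \<bar>C n\<bar> \<le> K"
    by (metis (no_types) convergent_imp_Bseq BseqE real_norm_def)
  have *: "u n - C n + (\<Sum>k<n. b k) \<le> u 0" for n
  proof (induction n)
    case (Suc n)
    then show ?case using step[of n] by (simp add: C_def)
  qed (simp add: C_def)
  show "summable b"
  proof (rule bounded_imp_summable)
    fix n
    show "(\<Sum>k\<le>n. b k) \<le> u 0 + K"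
      using *[of "Suc n"] K[of "Suc n"] nn(1)[of "Suc n"] by (simp add: lessThan_Suc_atMost)
  qed (use nn in auto)
  have dec: "decseq (\<lambda>n. u n - C n)"
  proof (rule decseq_SucI)
    fix n show "u (Suc n) - C (Suc n) \<le> u n - C n"
      using step[of n] nn(2)[of n] by (simp add: C_def)
  qed
  have "- K \<le> u n - C n" for n using K[of n] nn(1)[of n] by linarith
  then obtain L where "(\<lambda>n. u n - C n) \<longlonglongrightarrow> L"
    using decseq_convergent[OF dec] by metis
  then have "convergent (\<lambda>n. u n - C n)" by (auto simp: convergent_def)
  from convergent_add[OF this conv] show "convergent u" by simp
qed

section \<open>Series weighted by nonsummable steplengths\<close>

lemma summable_mult_frequently_small:
  fixes \<gamma> u :: "nat \<Rightarrow> real"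
  assumes "summable (\<lambda>k. \<gamma> k * u k)" "\<not> summable \<gamma>" "\<And>k. 0 < \<gamma> k" "0 < \<epsilon>"
  obtains n where "N \<le> n" "u n < \<epsilon>"
proof (rule ccontr)
  assume "\<not> thesis"
  then have *: "\<epsilon> \<le> u n" if "N \<le> n" for n using that \<open>\<And>n. N \<le> n \<Longrightarrow> u n < \<epsilon> \<Longrightarrow> thesis\<close> by force
  have "summable \<gamma>"
  proof (rule summable_comparison_test'[of "\<lambda>k. (1 / \<epsilon>) * (\<gamma> k * u k)" N])
    show "summable (\<lambda>k. (1 / \<epsilon>) * (\<gamma> k * u k))" using assms(1) by (rule summable_mult)
    fix n assume "N \<le> n"
    then have "\<gamma> n * \<epsilon> \<le> \<gamma> n * u n" using * assms(3)[of n] by simp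
    then show "norm (\<gamma> n) \<le> (1 / \<epsilon>) * (\<gamma> n * u n)"
      using assms(3)[of n] assms(4) by (simp add: field_simps)
  qed
  with assms(2) show False ..
qed

text \<open>A positive limit \<open>l\<close> would keep \<open>u\<close> above \<open>l / 2\<close>
  from some index on, whereas the weighted series forces values below \<open>l / 2\<close> at
  arbitrarily late indices.\<close>

lemma convergent_summable_mult_tendsto_0:
  fixes \<gamma> u :: "nat \<Rightarrow> real"
  assumes conv: "convergent u" and nn: "\<And>k. 0 \<le> u k"
    and "summable (\<lambda>k. \<gamma> k * u k)" "\<not> summable \<gamma>" "\<And>k. 0 < \<gamma> k"
  shows "u \<longlonglongrightarrow> 0"
proof -
  obtain l where l: "u \<longlonglongrightarrow> l" using conv by (auto simp: convergent_def)
  then have "0 \<le> l" using nn by (intro LIMSEQ_le_const) auto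
  moreover have "\<not> 0 < l"
  proof
    assume "0 < l"
    then have "\<forall>\<^sub>F n in sequentially. l / 2 < u n" using l by (intro order_tendstoD(1)) auto
    then obtain N where "\<And>n. N \<le> n \<Longrightarrow> l / 2 < u n" by (auto simp: eventually_sequentially)
    moreover have "0 < l / 2" using \<open>0 < l\<close> by simp
    from summable_mult_frequently_small[OF assms(3-5) this, of N]
    obtain n where "N \<le> n" "u n < l / 2" by blast
    ultimately show False by (meson less_asym)
  qed
  ultimately show ?thesis using l by simp
qed

text \<open>A Fejer argument: the distance to each minimizer converges, and the function values come
  arbitrarily close to the minimum, so some cluster point is a minimizer; the convergent distance to
  that point must then vanish. The statement concerns a single path, so the minimizer may depend on
  the path.\<close>

theorem projected_gradient_converges:
  fixes X :: "'a::euclidean_space set" and x r w :: "nat \<Rightarrow> 'a" and \<gamma> :: "nat \<Rightarrow> real"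
  assumes X: "compact X" "convex X" and x0: "x 0 \<in> X"
    and \<phi>: "convex_on X \<phi>" and grad: "\<And>y. y \<in> X \<Longrightarrow> (\<phi> has_derivative (\<lambda>h. G y \<bullet> h)) (at y)"
    and G: "continuous_on X G"
    and step: "\<And>k. x (Suc k) = closest_point X (x k - \<gamma> k *\<^sub>R (G (x k) + r k + w k))"
    and \<gamma>: "\<And>k. 0 < \<gamma> k" "\<not> summable \<gamma>" "summable (\<lambda>k. (\<gamma> k)\<^sup>2)"
    and r: "summable (\<lambda>k. \<gamma> k * norm (r k))"
    and w2: "summable (\<lambda>k. (\<gamma> k)\<^sup>2 * (norm (w k))\<^sup>2)"
    and wx: "summable (\<lambda>k. \<gamma> k * (x k \<bullet> w k))"
    and wb: "\<And>b. b \<in> Basis \<Longrightarrow> summable (\<lambda>k. \<gamma> k * (b \<bullet> w k))"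
  shows "\<exists>xl\<in>{z \<in> X. \<forall>y\<in>X. \<phi> z \<le> \<phi> y}. x \<longlonglongrightarrow> xl"
proof -
  have cX: "closed X" and neX: "X \<noteq> {}" using X x0 compact_imp_closed by auto
  have xX: "x k \<in> X" for k
    by (cases k) (use x0 step closest_point_in_set[OF cX neX] in auto)
  have \<phi>_cont: "continuous_on X \<phi>"
    using grad by (meson continuous_at_imp_continuous_on has_derivative_continuous)
  obtain z where z: "z \<in> X" "\<And>y. y \<in> X \<Longrightarrow> \<phi> z \<le> \<phi> y"
    using continuous_attains_inf[OF X(1) neX \<phi>_cont] by blast
  obtain D where D: "\<And>y. y \<in> X \<Longrightarrow> norm y \<le> D"
    using compact_imp_bounded[OF X(1)] by (auto simp: bounded_iff)
  obtain B where B: "\<And>y. y \<in> X \<Longrightarrow> norm (G y) \<le> B"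
    using compact_imp_bounded[OF compact_continuous_image[OF G X(1)]] by (auto simp: bounded_iff)
  \<comment> \<open>Summability eventually pushes \<open>\<gamma> k * norm (r k)\<close> below 1,
    where squaring only makes it smaller.\<close>
  have r2: "summable (\<lambda>k. (\<gamma> k)\<^sup>2 * (norm (r k))\<^sup>2)"
  proof -
    have "(\<lambda>k. \<gamma> k * norm (r k)) \<longlonglongrightarrow> 0" using r by (rule summable_LIMSEQ_zero)
    then have "\<forall>\<^sub>F k in sequentially. \<gamma> k * norm (r k) < 1" by (rule order_tendstoD) simp
    then have "\<forall>\<^sub>F k in sequentially. norm ((\<gamma> k)\<^sup>2 * (norm (r k))\<^sup>2) \<le> \<gamma> k * norm (r k)"
    proof eventually_elim
      case (elim k)
      have "(\<gamma> k * norm (r k))\<^sup>2 \<le> \<gamma> k * norm (r k)"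
        using elim \<gamma>(1)[of k] unfolding power2_eq_square
        by (intro mult_left_le) auto
      then show ?case by (simp add: power_mult_distrib)
    qed
    then show ?thesis using r by (rule summable_comparison_test_ev)
  qed
  \<comment> \<open>Expanding \<open>y\<close> in the finite basis reduces every direction to those
    covered by \<open>wb\<close>.\<close>
  have wy: "summable (\<lambda>k. \<gamma> k * (y \<bullet> w k))" for y
  proof -
    have "summable (\<lambda>k. \<Sum>b\<in>Basis. (y \<bullet> b) * (\<gamma> k * (b \<bullet> w k)))"
      by (intro summable_sum summable_mult wb)
    moreover have "(\<Sum>b\<in>Basis. (y \<bullet> b) * (\<gamma> k * (b \<bullet> w k))) = \<gamma> k * (y \<bullet> w k)" for k
      unfolding euclidean_inner[of y "w k"] sum_distrib_left
      by (intro sum.cong) (simp_all add: inner_commute mult_ac)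
    ultimately show ?thesis by simp
  qed
  have main: "convergent (\<lambda>k. (norm (x k - y))\<^sup>2)" "summable (\<lambda>k. \<gamma> k * (\<phi> (x k) - \<phi> y))"
    if y: "y \<in> X" "\<And>v. v \<in> X \<Longrightarrow> \<phi> y \<le> \<phi> v" for y
  proof -
    let ?b = "\<lambda>k. 2 * (\<gamma> k * (\<phi> (x k) - \<phi> y))"
    \<comment> \<open>The product of the noise with \<open>x k - y\<close> is split into two series
      already known to converge. In \<open>4 * D\<close>, the factor \<open>2 * D\<close> bounds the
      distance between points of \<open>X\<close>; the coefficients 4 of the squared terms come from
      bounding the square of a sum by twice the sum of squares, once for drift against noise and
      once for \<open>G\<close> against \<open>r\<close>.\<close>
    let ?c = "\<lambda>k. 4 * D * (\<gamma> k * norm (r k)) - 2 * (\<gamma> k * (x k \<bullet> w k)) + 2 * (\<gamma> k * (y \<bullet> w k))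
        + 4 * B\<^sup>2 * (\<gamma> k)\<^sup>2 + 4 * ((\<gamma> k)\<^sup>2 * (norm (r k))\<^sup>2) + 2 * ((\<gamma> k)\<^sup>2 * (norm (w k))\<^sup>2)"
    have c: "summable ?c"
      by (intro summable_add summable_diff summable_mult r r2 w2 wx wy \<gamma>)
    have le: "(norm (x (Suc k) - y))\<^sup>2 \<le> (norm (x k - y))\<^sup>2 - ?b k + ?c k" for k
    proof -
      let ?d = "G (x k) + r k"
      have "- (r k \<bullet> (x k - y)) \<le> norm (r k) * norm (x k - y)"
        using Cauchy_Schwarz_ineq2[of "r k" "x k - y"] by linarith
      also have "\<dots> \<le> norm (r k) * (2 * D)"
        using norm_triangle_ineq4[of "x k" y] D[OF xX[of k]] D[OF y(1)]
        by (intro mult_left_mono) auto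
      finally have "\<phi> (x k) - \<phi> y - 2 * D * norm (r k) \<le> ?d \<bullet> (x k - y)"
        using convex_on_gradient_le[OF \<phi> grad[OF xX[of k]] xX y(1)]
        by (simp add: inner_add_left inner_diff_right algebra_simps)
      then have 1: "\<gamma> k * (\<phi> (x k) - \<phi> y - 2 * D * norm (r k)) \<le> \<gamma> k * (?d \<bullet> (x k - y))"
        using \<gamma>(1)[of k] by simp
      have "(norm ?d)\<^sup>2 \<le> 2 * (norm (G (x k)))\<^sup>2 + 2 * (norm (r k))\<^sup>2"
        using inner_ge_zero[of "G (x k) - r k"] unfolding power2_norm_eq_inner
        by (simp add: inner_diff inner_add inner_commute algebra_simps)
      also have "\<dots> \<le> 2 * B\<^sup>2 + 2 * (norm (r k))\<^sup>2"
        using power_mono[OF B[OF xX[of k]], of 2] by simp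
      finally have 2: "(\<gamma> k)\<^sup>2 * (norm ?d)\<^sup>2 \<le> (\<gamma> k)\<^sup>2 * (2 * B\<^sup>2 + 2 * (norm (r k))\<^sup>2)"
        by (intro mult_left_mono) auto
      show ?thesis
        using closest_point_step[OF cX X(2) y(1), of "x k" "\<gamma> k" ?d "w k"] 1 2
        unfolding step[of k] by (simp add: inner_diff_right inner_commute algebra_simps)
    qed
    have b: "0 \<le> ?b k" for k using y(2)[OF xX[of k]] \<gamma>(1)[of k] by simp
    note pd = perturbed_descent[of "\<lambda>k. (norm (x k - y))\<^sup>2" ?b ?c, OF le _ b c]
    show "convergent (\<lambda>k. (norm (x k - y))\<^sup>2)" using pd by simp
    have "summable ?b" using pd by simp
    from summable_mult[OF this, of "1 / 2"]
    show "summable (\<lambda>k. \<gamma> k * (\<phi> (x k) - \<phi> y))" by simp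
  qed
  \<comment> \<open>The weighted value gaps are summable but the steplengths are not, so small gaps
    occur arbitrarily late; this yields a minimizing selection of iterates.\<close>
  have "\<exists>n\<ge>j. \<phi> (x n) - \<phi> z < 1 / real (Suc j)" for j
  proof -
    have "0 < 1 / real (Suc j)" by simp
    from summable_mult_frequently_small[OF main(2)[OF z] \<gamma>(2,1) this, of j] show ?thesis by metis
  qed
  then obtain m where m: "\<And>j. j \<le> m j" "\<And>j. \<phi> (x (m j)) - \<phi> z < 1 / real (Suc j)" by metis
  have "\<forall>n. (x \<circ> m) n \<in> X" using xX by simp
  then obtain xl s where s: "xl \<in> X" "strict_mono s" "((x \<circ> m) \<circ> s) \<longlonglongrightarrow> xl"
    using X(1) unfolding compact_def by metis
  have "(\<lambda>j. \<phi> (x (m j)) - \<phi> z) \<longlonglongrightarrow> 0"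
  proof (rule tendsto_sandwich[OF _ _ tendsto_const LIMSEQ_inverse_real_of_nat])
    show "\<forall>\<^sub>F j in sequentially. 0 \<le> \<phi> (x (m j)) - \<phi> z" using z(2)[OF xX] by simp
    show "\<forall>\<^sub>F j in sequentially. \<phi> (x (m j)) - \<phi> z \<le> inverse (real (Suc j))"
      using m(2) by (intro always_eventually allI less_imp_le) (simp only: inverse_eq_divide)
  qed
  then have "(\<lambda>j. \<phi> (x (m (s j))) - \<phi> z) \<longlonglongrightarrow> 0"
    using LIMSEQ_subseq_LIMSEQ[OF _ s(2)] by (force simp: o_def)
  moreover have "(\<lambda>j. \<phi> (x (m (s j))) - \<phi> z) \<longlonglongrightarrow> \<phi> xl - \<phi> z"
    using continuous_on_tendsto_compose[OF \<phi>_cont s(3) s(1)] xX by (intro tendsto_intros) (auto simp: o_def)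
  ultimately have "0 = \<phi> xl - \<phi> z" by (rule LIMSEQ_unique)
  then have "\<phi> xl = \<phi> z" by simp
  then have opt: "\<phi> xl \<le> \<phi> v" if "v \<in> X" for v using z(2) that by simp
  \<comment> \<open>The cluster point is itself a minimizer, so the distance result applies to it,
    and the limit can be identified along the selected indices.\<close>
  obtain l where l: "(\<lambda>k. (norm (x k - xl))\<^sup>2) \<longlonglongrightarrow> l"
    using main(1)[OF s(1) opt] by (auto simp: convergent_def)
  \<comment> \<open>\<open>m\<close> need not be increasing, but
    \<open>j \<le> s j \<le> m (s j)\<close> still sends the indices to infinity.\<close>
  have "filterlim (\<lambda>j. m (s j)) at_top sequentially"
    using order_trans[OF seq_suble[OF s(2)] m(1)]
    by (intro filterlim_at_top_mono[OF filterlim_ident]) auto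
  from filterlim_compose[OF l this] have "(\<lambda>j. (norm (x (m (s j)) - xl))\<^sup>2) \<longlonglongrightarrow> l" .
  moreover have "(\<lambda>j. (norm (x (m (s j)) - xl))\<^sup>2) \<longlonglongrightarrow> (norm (xl - xl))\<^sup>2"
    using s(3) by (intro tendsto_intros) (simp add: o_def)
  ultimately have "l = (norm (xl - xl))\<^sup>2" by (rule LIMSEQ_unique)
  then have "l = 0" by simp
  with l have "(\<lambda>k. norm (x k - xl)) \<longlonglongrightarrow> 0" using tendsto_real_sqrt[OF l] by simp
  then have "x \<longlonglongrightarrow> xl" by (rule LIM_zero_cancel[OF tendsto_norm_zero_cancel])
  with s(1) opt show ?thesis by blast
qed

section \<open>Almost sure convergence of square-integrable martingales\<close>

text \<open>Monotone convergence exchanges sum and integral, so the random sum has finite integral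
  and is finite almost everywhere.\<close>

lemma (in prob_space) AE_summable_expectation:
  fixes f :: "nat \<Rightarrow> 'a \<Rightarrow> real"
  assumes int: "\<And>k. integrable M (f k)" and nn: "\<And>k \<omega>. 0 \<le> f k \<omega>"
    and sm: "summable (\<lambda>k. expectation (f k))"
  shows "AE \<omega> in M. summable (\<lambda>k. f k \<omega>)"
proof -
  have [measurable]: "f k \<in> borel_measurable M" for k using int by auto
  have "(\<integral>\<^sup>+ \<omega>. (\<Sum>k. ennreal (f k \<omega>)) \<partial>M) = (\<Sum>k. \<integral>\<^sup>+ \<omega>. ennreal (f k \<omega>) \<partial>M)"
    by (intro nn_integral_suminf) auto
  also have "\<dots> = (\<Sum>k. ennreal (expectation (f k)))"
    using int nn by (simp add: nn_integral_eq_integral)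
  also have "\<dots> = ennreal (\<Sum>k. expectation (f k))"
    using sm nn by (intro suminf_ennreal2) auto
  finally have "AE \<omega> in M. (\<Sum>k. ennreal (f k \<omega>)) \<noteq> \<infinity>"
    by (intro nn_integral_noteq_infinite) auto
  then show ?thesis
    by eventually_elim (use nn in \<open>auto intro: summable_suminf_not_top\<close>)
qed

lemma integrable_mult_of_squares:
  fixes f g :: "'a \<Rightarrow> real"
  assumes "f \<in> borel_measurable M" "g \<in> borel_measurable M"
    and "integrable M (\<lambda>\<omega>. (f \<omega>)\<^sup>2)" "integrable M (\<lambda>\<omega>. (g \<omega>)\<^sup>2)"
  shows "integrable M (\<lambda>\<omega>. f \<omega> * g \<omega>)"
proof (rule Bochner_Integration.integrable_bound)
  show "integrable M (\<lambda>\<omega>. (f \<omega>)\<^sup>2 + (g \<omega>)\<^sup>2)" using assms by auto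
  show "AE \<omega> in M. norm (f \<omega> * g \<omega>) \<le> norm ((f \<omega>)\<^sup>2 + (g \<omega>)\<^sup>2)"
  proof (rule AE_I2)
    fix \<omega>
    have "2 * \<bar>f \<omega>\<bar> * \<bar>g \<omega>\<bar> \<le> (f \<omega>)\<^sup>2 + (g \<omega>)\<^sup>2"
      using sum_squares_bound[of "\<bar>f \<omega>\<bar>" "\<bar>g \<omega>\<bar>"] by simp
    moreover have "0 \<le> \<bar>f \<omega>\<bar> * \<bar>g \<omega>\<bar>" by simp
    ultimately show "norm (f \<omega> * g \<omega>) \<le> norm ((f \<omega>)\<^sup>2 + (g \<omega>)\<^sup>2)"
      unfolding real_norm_def abs_mult by linarith
  qed
qed (use assms in measurable)

section \<open>Martingale differences on a filtered probability space\<close>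

locale filtered_prob_space = prob_space M for M :: "'a measure" +
  fixes F :: "nat \<Rightarrow> 'a measure"
  assumes subalg: "\<And>k. subalgebra M (F k)"
    and filtration: "\<And>j k. j \<le> k \<Longrightarrow> subalgebra (F k) (F j)"
begin

lemma sigma_finite_F: "sigma_finite_subalgebra M (F k)"
  by (intro finite_measure_subalgebra_is_sigma_finite finite_measure_subalgebra.intro
      finite_measure_axioms finite_measure_subalgebra_axioms.intro subalg)

lemmas measurable_F_mono = measurable_from_subalg[OF filtration]
  and measurable_F_M = measurable_from_subalg[OF subalg]

text \<open>The index is shifted to fit the scheme: the difference with index \<open>k\<close>
  becomes known at time \<open>Suc k\<close> and is centred given the past \<open>F k\<close>, which
  contains iterate \<open>k\<close>.\<close>

definition mart_diff :: "(nat \<Rightarrow> 'a \<Rightarrow> real) \<Rightarrow> bool" where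
  "mart_diff d \<longleftrightarrow> (\<forall>k. d k \<in> borel_measurable (F (Suc k)) \<and> integrable M (\<lambda>\<omega>. (d k \<omega>)\<^sup>2)
      \<and> (AE \<omega> in M. real_cond_exp M (F k) (d k) \<omega> = 0))"

lemma expectation_mult_cond_exp_0:
  assumes "Z \<in> borel_measurable (F k)" "d \<in> borel_measurable M" "integrable M (\<lambda>\<omega>. Z \<omega> * d \<omega>)"
    and "AE \<omega> in M. real_cond_exp M (F k) d \<omega> = 0"
  shows "expectation (\<lambda>\<omega>. Z \<omega> * d \<omega>) = 0"
proof -
  have "expectation (\<lambda>\<omega>. Z \<omega> * d \<omega>) = expectation (\<lambda>\<omega>. Z \<omega> * real_cond_exp M (F k) d \<omega>)"
    using sigma_finite_subalgebra.real_cond_exp_intg(2)[OF sigma_finite_F assms(3,1,2)] by simp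
  also have "\<dots> = 0" using assms(4) by (intro integral_eq_zero_AE) auto
  finally show ?thesis .
qed

text \<open>Kolmogorov's inequality, from Chebyshev's inequality for the martingale stopped when it
  leaves the interval of radius \<open>\<epsilon>\<close>; up to that time the martingale is bounded, which makes
  the cross terms integrable.\<close>

lemma mart_diff_maximal:
  assumes d: "mart_diff d" and \<epsilon>: "0 < \<epsilon>"
  shows "prob {\<omega> \<in> space M. \<exists>j\<le>n. \<epsilon> \<le> \<bar>\<Sum>k<j. d k \<omega>\<bar>} \<le> (\<Sum>k<n. expectation (\<lambda>\<omega>. (d k \<omega>)\<^sup>2)) / \<epsilon>\<^sup>2"
proof -
  define S where "S j \<omega> = (\<Sum>k<j. d k \<omega>)" for j \<omega>
  \<comment> \<open>\<open>I j\<close> indicates that no partial sum up to time \<open>j\<close> has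
    left the interval. It is known at time \<open>j\<close>, before \<open>d j\<close> is revealed,
    so \<open>T\<close> is a martingale transform of the differences.\<close>
  define I where "I j \<omega> = (if \<forall>i\<le>j. \<bar>S i \<omega>\<bar> < \<epsilon> then 1 else 0 :: real)" for j \<omega>
  define T where "T j \<omega> = (\<Sum>k<j. I k \<omega> * d k \<omega>)" for j \<omega>
  have d_F: "d k \<in> borel_measurable (F j)" if "k < j" for k j
    using d measurable_F_mono[of "Suc k" j] that unfolding mart_diff_def by (meson Suc_leI)
  have dM[measurable]: "d k \<in> borel_measurable M" for k
    using d_F[of k "Suc k"] measurable_F_M by blast
  have d2: "integrable M (\<lambda>\<omega>. (d k \<omega>)\<^sup>2)" for k using d by (auto simp: mart_diff_def)
  have S_F: "S i \<in> borel_measurable (F j)" if "i \<le> j" for i j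
    unfolding S_def using that by (intro borel_measurable_sum d_F) auto
  have I_F: "I i \<in> borel_measurable (F j)" if "i \<le> j" for i j
  proof -
    have [measurable]: "S l \<in> borel_measurable (F j)" if "l \<in> {..i}" for l
      using S_F that \<open>i \<le> j\<close> by auto
    have "I i = (\<lambda>\<omega>. if \<forall>l\<in>{..i}. \<bar>S l \<omega>\<bar> < \<epsilon> then 1 else 0)" by (auto simp: I_def fun_eq_iff)
    also have "\<dots> \<in> borel_measurable (F j)" by measurable
    finally show ?thesis .
  qed
  have T_F: "T i \<in> borel_measurable (F j)" if "i \<le> j" for i j
    unfolding T_def using that by (intro borel_measurable_sum borel_measurable_times I_F d_F) auto
  have [measurable]: "I i \<in> borel_measurable M" "T i \<in> borel_measurable M" "S i \<in> borel_measurable M" for i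
    using I_F[of i i] T_F[of i i] S_F[of i i] measurable_F_M by blast+
  \<comment> \<open>Before the exit \<open>T\<close> agrees with \<open>S\<close>; afterwards it is
    frozen at the first value outside the interval, overshoot included.\<close>
  have stop: "(I n \<omega> = 1 \<and> T n \<omega> = S n \<omega> \<and> \<bar>S n \<omega>\<bar> < \<epsilon>) \<or> (I n \<omega> = 0 \<and> \<epsilon> \<le> \<bar>T n \<omega>\<bar>)" for n \<omega>
  proof (induction n)
    case 0 show ?case using \<epsilon> by (simp add: I_def S_def T_def)
  next
    case (Suc n)
    have T: "T (Suc n) \<omega> = T n \<omega> + I n \<omega> * d n \<omega>" and S: "S (Suc n) \<omega> = S n \<omega> + d n \<omega>"
      by (simp_all add: T_def S_def)
    have I: "I (Suc n) \<omega> = (if \<bar>S (Suc n) \<omega>\<bar> < \<epsilon> then I n \<omega> else 0)"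
      by (auto simp: I_def le_Suc_eq)
    show ?case using Suc.IH unfolding T S I by auto
  qed
  have T2: "integrable M (\<lambda>\<omega>. (T n \<omega>)\<^sup>2) \<and> expectation (\<lambda>\<omega>. (T n \<omega>)\<^sup>2) \<le> (\<Sum>k<n. expectation (\<lambda>\<omega>. (d k \<omega>)\<^sup>2))" for n
  proof (induction n)
    case 0 show ?case by (simp add: T_def)
  next
    case (Suc n)
    \<comment> \<open>\<open>T n\<close> may overshoot on stopped paths, but the factor
      \<open>I n\<close> removes exactly those, so \<open>Z\<close> is bounded by
      \<open>\<epsilon>\<close>.\<close>
    define Z where "Z \<omega> = T n \<omega> * I n \<omega>" for \<omega>
    have Z_F: "Z \<in> borel_measurable (F n)"
      unfolding Z_def by (intro borel_measurable_times T_F I_F) auto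
    then have [measurable]: "Z \<in> borel_measurable M" by (rule measurable_F_M)
    have Zb: "\<bar>Z \<omega>\<bar> \<le> \<epsilon>" for \<omega> using stop[of n \<omega>] \<epsilon> by (auto simp: Z_def)
    have "integrable M (\<lambda>\<omega>. (Z \<omega>)\<^sup>2)"
    proof (rule integrable_const_bound[where B = "\<epsilon>\<^sup>2"])
      show "AE \<omega> in M. norm ((Z \<omega>)\<^sup>2) \<le> \<epsilon>\<^sup>2" using Zb \<epsilon> by (auto simp: power2_le_iff_abs_le)
    qed auto
    then have Zd: "integrable M (\<lambda>\<omega>. Z \<omega> * d n \<omega>)"
      using d2 by (intro integrable_mult_of_squares) auto
    have Zd0: "expectation (\<lambda>\<omega>. Z \<omega> * d n \<omega>) = 0"
      using d by (intro expectation_mult_cond_exp_0[OF Z_F _ Zd]) (auto simp: mart_diff_def)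
    have Id: "integrable M (\<lambda>\<omega>. (I n \<omega> * d n \<omega>)\<^sup>2)"
      by (rule Bochner_Integration.integrable_bound[OF d2[of n]]) (auto simp: I_def)
    have eq: "(T (Suc n) \<omega>)\<^sup>2 = (T n \<omega>)\<^sup>2 + 2 * (Z \<omega> * d n \<omega>) + (I n \<omega> * d n \<omega>)\<^sup>2" for \<omega>
      by (simp add: T_def Z_def power2_eq_square algebra_simps)
    have "expectation (\<lambda>\<omega>. (T (Suc n) \<omega>)\<^sup>2)
        = expectation (\<lambda>\<omega>. (T n \<omega>)\<^sup>2) + expectation (\<lambda>\<omega>. (I n \<omega> * d n \<omega>)\<^sup>2)"
      unfolding eq using Suc.IH Zd Zd0 Id by simp
    moreover have "expectation (\<lambda>\<omega>. (I n \<omega> * d n \<omega>)\<^sup>2) \<le> expectation (\<lambda>\<omega>. (d n \<omega>)\<^sup>2)"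
      by (rule integral_mono[OF Id d2]) (auto simp: I_def)
    moreover have "integrable M (\<lambda>\<omega>. (T (Suc n) \<omega>)\<^sup>2)"
      unfolding eq using Suc.IH Zd Id by simp
    ultimately show ?case using Suc.IH by simp
  qed
  have "prob {\<omega> \<in> space M. \<exists>j\<le>n. \<epsilon> \<le> \<bar>\<Sum>k<j. d k \<omega>\<bar>} \<le> prob {\<omega> \<in> space M. \<epsilon>\<^sup>2 \<le> (T n \<omega>)\<^sup>2}"
  proof (rule finite_measure_mono)
    show "{\<omega> \<in> space M. \<exists>j\<le>n. \<epsilon> \<le> \<bar>\<Sum>k<j. d k \<omega>\<bar>} \<subseteq> {\<omega> \<in> space M. \<epsilon>\<^sup>2 \<le> (T n \<omega>)\<^sup>2}"
    proof clarify
      fix \<omega> j assume "j \<le> n" "\<epsilon> \<le> \<bar>\<Sum>k<j. d k \<omega>\<bar>"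
      then have "I n \<omega> = 0" by (force simp: I_def S_def)
      then have "\<epsilon> \<le> \<bar>T n \<omega>\<bar>" using stop[of n \<omega>] by simp
      then show "\<epsilon>\<^sup>2 \<le> (T n \<omega>)\<^sup>2" using \<epsilon> by (simp add: power2_le_iff_abs_le abs_le_square_iff[symmetric])
    qed
  qed measurable
  also have "\<dots> \<le> expectation (\<lambda>\<omega>. (T n \<omega>)\<^sup>2) / \<epsilon>\<^sup>2"
    using T2 \<epsilon> by (intro integral_Markov_inequality_measure[where A = "space M" and u = "\<lambda>\<omega>. (T n \<omega>)\<^sup>2", simplified]) auto
  also have "\<dots> \<le> (\<Sum>k<n. expectation (\<lambda>\<omega>. (d k \<omega>)\<^sup>2)) / \<epsilon>\<^sup>2"
    using T2 by (intro divide_right_mono) auto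
  finally show ?thesis .
qed

text \<open>The maximal inequality is applied to the sequence whose first \<open>N\<close> terms are
  replaced by 0, which is again a martingale difference sequence; continuity from below then removes
  the finite horizon.\<close>

lemma mart_diff_tail:
  assumes d: "mart_diff d" and sm: "summable (\<lambda>k. expectation (\<lambda>\<omega>. (d k \<omega>)\<^sup>2))" and \<epsilon>: "0 < \<epsilon>"
  shows "prob {\<omega> \<in> space M. \<exists>j\<ge>N. \<epsilon> \<le> \<bar>\<Sum>k=N..<j. d k \<omega>\<bar>} \<le> (\<Sum>k. expectation (\<lambda>\<omega>. (d (k + N) \<omega>)\<^sup>2)) / \<epsilon>\<^sup>2"
proof -
  define d' where "d' k \<omega> = (if k < N then 0 else d k \<omega>)" for k \<omega>
  have dM[measurable]: "d k \<in> borel_measurable M" for k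
    using d measurable_F_M unfolding mart_diff_def by blast
  have "mart_diff d'"
    unfolding mart_diff_def
  proof (intro allI)
    fix k
    have "AE \<omega> in M. real_cond_exp M (F k) (\<lambda>_. 0) \<omega> = 0"
      by (rule sigma_finite_subalgebra.real_cond_exp_F_meas[OF sigma_finite_F]) auto
    then show "d' k \<in> borel_measurable (F (Suc k)) \<and> integrable M (\<lambda>\<omega>. (d' k \<omega>)\<^sup>2)
        \<and> (AE \<omega> in M. real_cond_exp M (F k) (d' k) \<omega> = 0)"
      using d unfolding mart_diff_def d'_def by (cases "k < N") auto
  qed
  note max = mart_diff_maximal[OF this \<epsilon>]
  have d'_sum: "(\<Sum>k<j. d' k \<omega>) = (\<Sum>k=N..<j. d k \<omega>)" for j \<omega>
    unfolding d'_def by (rule sum.mono_neutral_cong_right) auto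
  let ?A = "\<lambda>n. {\<omega> \<in> space M. \<exists>j\<le>n. \<epsilon> \<le> \<bar>\<Sum>k=N..<j. d k \<omega>\<bar>}"
  have sumle: "(\<Sum>k<n. expectation (\<lambda>\<omega>. (d' k \<omega>)\<^sup>2)) \<le> (\<Sum>k. expectation (\<lambda>\<omega>. (d (k + N) \<omega>)\<^sup>2))" for n
  proof -
    have "(\<Sum>k<n. expectation (\<lambda>\<omega>. (d' k \<omega>)\<^sup>2)) \<le> (\<Sum>k<n+N. expectation (\<lambda>\<omega>. (d' k \<omega>)\<^sup>2))"
      by (intro sum_mono2) auto
    also have "\<dots> = (\<Sum>k=N..<n+N. expectation (\<lambda>\<omega>. (d k \<omega>)\<^sup>2))"
      by (rule sum.mono_neutral_cong_right) (auto simp: d'_def)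
    also have "\<dots> = (\<Sum>k<n. expectation (\<lambda>\<omega>. (d (k + N) \<omega>)\<^sup>2))"
      using sum.shift_bounds_nat_ivl[of "\<lambda>k. expectation (\<lambda>\<omega>. (d k \<omega>)\<^sup>2)" 0 N n] by (simp add: atLeast0LessThan)
    also have "\<dots> \<le> (\<Sum>k. expectation (\<lambda>\<omega>. (d (k + N) \<omega>)\<^sup>2))"
      using sm by (intro sum_le_suminf) (auto simp: summable_iff_shift[of "\<lambda>k. expectation (\<lambda>\<omega>. (d k \<omega>)\<^sup>2)"])
    finally show ?thesis .
  qed
  have "(\<lambda>n. prob (?A n)) \<longlonglongrightarrow> prob (\<Union>n. ?A n)"
    by (rule finite_Lim_measure_incseq) (auto simp: incseq_def intro: le_trans)
  moreover have "prob (?A n) \<le> (\<Sum>k. expectation (\<lambda>\<omega>. (d (k + N) \<omega>)\<^sup>2)) / \<epsilon>\<^sup>2" for n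
    using max[of n] divide_right_mono[OF sumle, of "\<epsilon>\<^sup>2" n] unfolding d'_sum by simp
  ultimately have "prob (\<Union>n. ?A n) \<le> (\<Sum>k. expectation (\<lambda>\<omega>. (d (k + N) \<omega>)\<^sup>2)) / \<epsilon>\<^sup>2"
    by (intro LIMSEQ_le_const2) auto
  moreover have "prob {\<omega> \<in> space M. \<exists>j\<ge>N. \<epsilon> \<le> \<bar>\<Sum>k=N..<j. d k \<omega>\<bar>} \<le> prob (\<Union>n. ?A n)"
    by (intro finite_measure_mono) auto
  ultimately show ?thesis by linarith
qed

text \<open>The tail bounds tend to 0, so for each \<open>i\<close> almost surely some tail has all
  its partial sums below \<open>1 / Suc i\<close>. Intersecting over the countably many
  \<open>i\<close> makes the partial sums Cauchy.\<close>

theorem mart_diff_AE_summable: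
  assumes d: "mart_diff d" and sm: "summable (\<lambda>k. expectation (\<lambda>\<omega>. (d k \<omega>)\<^sup>2))"
  shows "AE \<omega> in M. summable (\<lambda>k. d k \<omega>)"
proof -
  have dM[measurable]: "d k \<in> borel_measurable M" for k
    using d measurable_F_M unfolding mart_diff_def by blast
  have "AE \<omega> in M. \<exists>N. \<forall>j\<ge>N. \<bar>\<Sum>k=N..<j. d k \<omega>\<bar> < 1 / real (Suc i)" for i
  proof -
    let ?\<epsilon> = "1 / real (Suc i)"
    let ?B = "\<lambda>N. {\<omega> \<in> space M. \<exists>j\<ge>N. ?\<epsilon> \<le> \<bar>\<Sum>k=N..<j. d k \<omega>\<bar>}"
    have B[measurable]: "?B N \<in> sets M" for N by measurable
    have "prob (\<Inter>N. ?B N) \<le> (\<Sum>k. expectation (\<lambda>\<omega>. (d (k + N) \<omega>)\<^sup>2)) / ?\<epsilon>\<^sup>2" for N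
    proof -
      have "prob (\<Inter>N. ?B N) \<le> prob (?B N)" by (rule finite_measure_mono) (auto intro: B)
      also have "\<dots> \<le> (\<Sum>k. expectation (\<lambda>\<omega>. (d (k + N) \<omega>)\<^sup>2)) / ?\<epsilon>\<^sup>2"
        by (rule mart_diff_tail[OF d sm]) simp
      finally show ?thesis .
    qed
    moreover have "(\<lambda>N. (\<Sum>k. expectation (\<lambda>\<omega>. (d (k + N) \<omega>)\<^sup>2)) / ?\<epsilon>\<^sup>2) \<longlonglongrightarrow> 0 / ?\<epsilon>\<^sup>2"
      by (intro tendsto_divide suminf_exist_split2[OF sm] tendsto_const) simp
    ultimately have "prob (\<Inter>N. ?B N) \<le> 0 / ?\<epsilon>\<^sup>2"
      by (intro LIMSEQ_le_const) blast+
    then have "prob (\<Inter>N. ?B N) = 0" using measure_nonneg[of M "\<Inter>N. ?B N"] by linarith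
    then have "AE \<omega> in M. \<omega> \<notin> (\<Inter>N. ?B N)"
      by (subst (asm) prob_eq_0) auto
    then show ?thesis
      using AE_space
    proof eventually_elim
      case (elim \<omega>)
      then show ?case by (auto simp: not_le simp del: of_nat_Suc) (meson not_less)
    qed
  qed
  then have "AE \<omega> in M. \<forall>i. \<exists>N. \<forall>j\<ge>N. \<bar>\<Sum>k=N..<j. d k \<omega>\<bar> < 1 / real (Suc i)"
    by (simp add: AE_all_countable)
  then show ?thesis
  proof eventually_elim
    case (elim \<omega>)
    have "Cauchy (\<lambda>n. \<Sum>k<n. d k \<omega>)"
    proof (rule metric_CauchyI)
      fix e :: real assume "0 < e"
      then obtain i where i: "1 / real (Suc i) < e / 2"
        using nat_approx_posE[of "e / 2"] by auto
      obtain N where N: "\<And>j. N \<le> j \<Longrightarrow> \<bar>\<Sum>k=N..<j. d k \<omega>\<bar> < 1 / real (Suc i)" using elim by blast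
      have "dist (\<Sum>k<m. d k \<omega>) (\<Sum>k<n. d k \<omega>) < e" if "N \<le> m" "N \<le> n" for m n
      proof -
        have split: "(\<Sum>k<j. d k \<omega>) = (\<Sum>k<N. d k \<omega>) + (\<Sum>k=N..<j. d k \<omega>)" if "N \<le> j" for j
          using sum.atLeastLessThan_concat[of 0 N j "\<lambda>k. d k \<omega>"] that by (simp add: atLeast0LessThan)
        show ?thesis
          using N[OF that(1)] N[OF that(2)] i unfolding split[OF that(1)] split[OF that(2)] dist_real_def
          by linarith
      qed
      then show "\<exists>N. \<forall>m\<ge>N. \<forall>n\<ge>N. dist (\<Sum>k<m. d k \<omega>) (\<Sum>k<n. d k \<omega>) < e" by blast
    qed
    then show ?case unfolding summable_iff_convergent by (rule Cauchy_convergent)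
  qed
qed

section \<open>Stochastic projected gradient method\<close>

text \<open>Centring is stated by coordinates because \<open>real_cond_exp\<close> is real valued.
  The second moment uses \<open>nn_cond_exp\<close>, which makes sense before any integrability is
  known; square integrability of the noise is then a consequence.\<close>

definition noise :: "(nat \<Rightarrow> 'a \<Rightarrow> 'e::euclidean_space) \<Rightarrow> real \<Rightarrow> bool" where
  "noise w \<nu> \<longleftrightarrow> (\<forall>k. w k \<in> borel_measurable (F (Suc k))
      \<and> (\<forall>b\<in>Basis. AE \<omega> in M. real_cond_exp M (F k) (\<lambda>\<omega>. w k \<omega> \<bullet> b) \<omega> = 0)
      \<and> (AE \<omega> in M. nn_cond_exp M (F k) (\<lambda>\<omega>. ennreal ((norm (w k \<omega>))\<^sup>2)) \<omega> \<le> ennreal (\<nu>\<^sup>2)))"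

text \<open>A nonnegative \<open>F k\<close>-measurable weight passes through
  \<open>nn_cond_exp\<close>, so integrability of the product and its bound come out of one
  computation in \<open>ennreal\<close>. The weights used are 1 and squared norms of adapted
  vectors.\<close>

lemma noise_second_moment:
  fixes w :: "nat \<Rightarrow> 'a \<Rightarrow> 'e::euclidean_space"
  assumes w: "noise w \<nu>" and Z: "Z \<in> borel_measurable (F k)" "\<And>\<omega>. 0 \<le> Z \<omega>" "integrable M Z"
  shows "integrable M (\<lambda>\<omega>. Z \<omega> * (norm (w k \<omega>))\<^sup>2)"
    and "expectation (\<lambda>\<omega>. Z \<omega> * (norm (w k \<omega>))\<^sup>2) \<le> \<nu>\<^sup>2 * expectation Z"
proof -
  have [measurable]: "w k \<in> borel_measurable M" using w measurable_F_M unfolding noise_def by blast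
  have [measurable]: "Z \<in> borel_measurable M" using Z by auto
  have "(\<integral>\<^sup>+ \<omega>. ennreal (Z \<omega> * (norm (w k \<omega>))\<^sup>2) \<partial>M) = (\<integral>\<^sup>+ \<omega>. ennreal (Z \<omega>) * ennreal ((norm (w k \<omega>))\<^sup>2) \<partial>M)"
    using Z(2) by (simp add: ennreal_mult)
  also have "\<dots> = (\<integral>\<^sup>+ \<omega>. ennreal (Z \<omega>) * nn_cond_exp M (F k) (\<lambda>\<omega>. ennreal ((norm (w k \<omega>))\<^sup>2)) \<omega> \<partial>M)"
    using Z(1) by (intro sigma_finite_subalgebra.nn_cond_exp_intg[OF sigma_finite_F, symmetric]) auto
  also have "\<dots> \<le> (\<integral>\<^sup>+ \<omega>. ennreal (Z \<omega>) * ennreal (\<nu>\<^sup>2) \<partial>M)"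
  proof (rule nn_integral_mono_AE)
    have "AE \<omega> in M. nn_cond_exp M (F k) (\<lambda>\<omega>. ennreal ((norm (w k \<omega>))\<^sup>2)) \<omega> \<le> ennreal (\<nu>\<^sup>2)"
      using w by (auto simp: noise_def)
    then show "AE \<omega> in M. ennreal (Z \<omega>) * nn_cond_exp M (F k) (\<lambda>\<omega>. ennreal ((norm (w k \<omega>))\<^sup>2)) \<omega>
        \<le> ennreal (Z \<omega>) * ennreal (\<nu>\<^sup>2)"
      by eventually_elim (rule mult_left_mono, auto)
  qed
  also have "\<dots> = (\<integral>\<^sup>+ \<omega>. ennreal (\<nu>\<^sup>2 * Z \<omega>) \<partial>M)"
    using Z(2) by (simp add: ennreal_mult mult.commute)
  also have "\<dots> = ennreal (\<nu>\<^sup>2 * expectation Z)"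
    using Z by (subst nn_integral_eq_integral) auto
  finally have *: "(\<integral>\<^sup>+ \<omega>. ennreal (Z \<omega> * (norm (w k \<omega>))\<^sup>2) \<partial>M) \<le> ennreal (\<nu>\<^sup>2 * expectation Z)" .
  show int: "integrable M (\<lambda>\<omega>. Z \<omega> * (norm (w k \<omega>))\<^sup>2)"
  proof (rule integrableI_bounded)
    show "(\<integral>\<^sup>+ \<omega>. ennreal (norm (Z \<omega> * (norm (w k \<omega>))\<^sup>2)) \<partial>M) < \<infinity>"
      using * Z(2) by (simp add: abs_mult le_less_trans)
  qed measurable
  have "ennreal (expectation (\<lambda>\<omega>. Z \<omega> * (norm (w k \<omega>))\<^sup>2)) \<le> ennreal (\<nu>\<^sup>2 * expectation Z)"
    using * int Z(2) by (subst nn_integral_eq_integral[symmetric]) auto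
  then show "expectation (\<lambda>\<omega>. Z \<omega> * (norm (w k \<omega>))\<^sup>2) \<le> \<nu>\<^sup>2 * expectation Z"
    using Z by (subst (asm) ennreal_le_iff) (auto intro!: mult_nonneg_nonneg integral_nonneg)
qed

lemma noise_norm2:
  fixes w :: "nat \<Rightarrow> 'a \<Rightarrow> 'e::euclidean_space"
  assumes "noise w \<nu>"
  shows "integrable M (\<lambda>\<omega>. (norm (w k \<omega>))\<^sup>2)" "expectation (\<lambda>\<omega>. (norm (w k \<omega>))\<^sup>2) \<le> \<nu>\<^sup>2"
proof -
  note one = noise_second_moment[OF assms, where Z = "\<lambda>_. 1" and k = k, unfolded mult_1_left]
  show "integrable M (\<lambda>\<omega>. (norm (w k \<omega>))\<^sup>2)" by (rule one(1)) auto
  have "expectation (\<lambda>\<omega>. (norm (w k \<omega>))\<^sup>2) \<le> \<nu>\<^sup>2 * expectation (\<lambda>_. 1)" by (rule one(2)) auto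
  then show "expectation (\<lambda>\<omega>. (norm (w k \<omega>))\<^sup>2) \<le> \<nu>\<^sup>2" by (simp add: prob_space)
qed

text \<open>Each coordinate of \<open>y\<close> is known at time \<open>k\<close> and factors out of
  the conditional expectation, the products being integrable since both factors are square
  integrable. The second moment follows from Cauchy-Schwarz with the squared norm of
  \<open>y\<close> as weight.\<close>

lemma noise_inner:
  fixes w :: "nat \<Rightarrow> 'a \<Rightarrow> 'e::euclidean_space"
  assumes w: "noise w \<nu>" and y: "y \<in> borel_measurable (F k)" "integrable M (\<lambda>\<omega>. (norm (y \<omega>))\<^sup>2)"
  shows "integrable M (\<lambda>\<omega>. y \<omega> \<bullet> w k \<omega>)" "integrable M (\<lambda>\<omega>. (y \<omega> \<bullet> w k \<omega>)\<^sup>2)"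
    and "expectation (\<lambda>\<omega>. (y \<omega> \<bullet> w k \<omega>)\<^sup>2) \<le> \<nu>\<^sup>2 * expectation (\<lambda>\<omega>. (norm (y \<omega>))\<^sup>2)"
    and "AE \<omega> in M. real_cond_exp M (F k) (\<lambda>\<omega>. y \<omega> \<bullet> w k \<omega>) \<omega> = 0"
    and "expectation (\<lambda>\<omega>. y \<omega> \<bullet> w k \<omega>) = 0"
proof -
  have [measurable]: "w k \<in> borel_measurable M" using w measurable_F_M unfolding noise_def by blast
  have [measurable]: "y \<in> borel_measurable M" using y(1) by (rule measurable_F_M)
  have "(\<lambda>\<omega>. (norm (y \<omega>))\<^sup>2) \<in> borel_measurable (F k)" using y(1) by measurable
  note moment = noise_second_moment[OF w this _ y(2)]
  have le: "(y \<omega> \<bullet> w k \<omega>)\<^sup>2 \<le> (norm (y \<omega>))\<^sup>2 * (norm (w k \<omega>))\<^sup>2" for \<omega>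
    using Cauchy_Schwarz_ineq[of "y \<omega>" "w k \<omega>"] by (simp add: power2_norm_eq_inner)
  show sq: "integrable M (\<lambda>\<omega>. (y \<omega> \<bullet> w k \<omega>)\<^sup>2)"
    by (rule Bochner_Integration.integrable_bound[OF moment(1)]) (use le in auto)
  have "expectation (\<lambda>\<omega>. (y \<omega> \<bullet> w k \<omega>)\<^sup>2) \<le> expectation (\<lambda>\<omega>. (norm (y \<omega>))\<^sup>2 * (norm (w k \<omega>))\<^sup>2)"
    by (rule integral_mono[OF sq moment(1)]) (use le in auto)
  also have "\<dots> \<le> \<nu>\<^sup>2 * expectation (\<lambda>\<omega>. (norm (y \<omega>))\<^sup>2)" by (rule moment(2)) simp
  finally show "expectation (\<lambda>\<omega>. (y \<omega> \<bullet> w k \<omega>)\<^sup>2) \<le> \<nu>\<^sup>2 * expectation (\<lambda>\<omega>. (norm (y \<omega>))\<^sup>2)" .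
  note w2 = noise_norm2(1)[OF w, of k]
  have component: "integrable M (\<lambda>\<omega>. (x \<omega> \<bullet> b)\<^sup>2)"
    if "integrable M (\<lambda>\<omega>. (norm (x \<omega>))\<^sup>2)" "x \<in> borel_measurable M" for x :: "'a \<Rightarrow> 'e" and b
  proof (rule Bochner_Integration.integrable_bound)
    show "integrable M (\<lambda>\<omega>. (norm b)\<^sup>2 * (norm (x \<omega>))\<^sup>2)" using that by simp
    show "AE \<omega> in M. norm ((x \<omega> \<bullet> b)\<^sup>2) \<le> norm ((norm b)\<^sup>2 * (norm (x \<omega>))\<^sup>2)"
      using Cauchy_Schwarz_ineq[of "x _" b] by (auto simp: power2_norm_eq_inner mult.commute)
  qed (use that in measurable)
  have yw: "integrable M (\<lambda>\<omega>. (y \<omega> \<bullet> b) * (w k \<omega> \<bullet> b))" for b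
    using component y(2) w2 by (intro integrable_mult_of_squares) auto
  have eq: "(\<lambda>\<omega>. y \<omega> \<bullet> w k \<omega>) = (\<lambda>\<omega>. \<Sum>b\<in>Basis. (y \<omega> \<bullet> b) * (w k \<omega> \<bullet> b))"
    by (rule ext) (rule euclidean_inner)
  show int: "integrable M (\<lambda>\<omega>. y \<omega> \<bullet> w k \<omega>)"
    unfolding eq using yw by (intro Bochner_Integration.integrable_sum) auto
  have "AE \<omega> in M. \<forall>b\<in>Basis. real_cond_exp M (F k) (\<lambda>\<omega>. (y \<omega> \<bullet> b) * (w k \<omega> \<bullet> b)) \<omega> = 0"
  proof (rule AE_finite_allI)
    fix b :: 'e assume b: "b \<in> Basis"
    have "(\<lambda>\<omega>. y \<omega> \<bullet> b) \<in> borel_measurable (F k)" using y(1) by measurable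
    from sigma_finite_subalgebra.real_cond_exp_mult[OF sigma_finite_F this _ yw]
    have "AE \<omega> in M. real_cond_exp M (F k) (\<lambda>\<omega>. (y \<omega> \<bullet> b) * (w k \<omega> \<bullet> b)) \<omega>
        = (y \<omega> \<bullet> b) * real_cond_exp M (F k) (\<lambda>\<omega>. w k \<omega> \<bullet> b) \<omega>" by simp
    moreover have "AE \<omega> in M. real_cond_exp M (F k) (\<lambda>\<omega>. w k \<omega> \<bullet> b) \<omega> = 0"
      using w b by (auto simp: noise_def)
    ultimately show "AE \<omega> in M. real_cond_exp M (F k) (\<lambda>\<omega>. (y \<omega> \<bullet> b) * (w k \<omega> \<bullet> b)) \<omega> = 0"
      by eventually_elim simp
  qed simp
  moreover have "AE \<omega> in M. real_cond_exp M (F k) (\<lambda>\<omega>. \<Sum>b\<in>Basis. (y \<omega> \<bullet> b) * (w k \<omega> \<bullet> b)) \<omega>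
      = (\<Sum>b\<in>Basis. real_cond_exp M (F k) (\<lambda>\<omega>. (y \<omega> \<bullet> b) * (w k \<omega> \<bullet> b)) \<omega>)"
    by (rule sigma_finite_subalgebra.real_cond_exp_sum[OF sigma_finite_F yw])
  ultimately show ce: "AE \<omega> in M. real_cond_exp M (F k) (\<lambda>\<omega>. y \<omega> \<bullet> w k \<omega>) \<omega> = 0"
    unfolding eq by eventually_elim simp
  show "expectation (\<lambda>\<omega>. y \<omega> \<bullet> w k \<omega>) = 0"
    using expectation_mult_cond_exp_0[of "\<lambda>_. 1" k, OF _ _ _ ce] int by simp
qed

text \<open>The terms are martingale differences with second moments at most
  \<open>(a k)\<^sup>2 * \<nu>\<^sup>2 * K\<close>, which are summable.\<close>

lemma noise_AE_summable_inner:
  fixes w y :: "nat \<Rightarrow> 'a \<Rightarrow> 'e::euclidean_space"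
  assumes w: "noise w \<nu>" and y: "\<And>k. y k \<in> borel_measurable (F k)"
      "\<And>k. integrable M (\<lambda>\<omega>. (norm (y k \<omega>))\<^sup>2)" "\<And>k. expectation (\<lambda>\<omega>. (norm (y k \<omega>))\<^sup>2) \<le> K"
    and a: "summable (\<lambda>k. (a k)\<^sup>2)"
  shows "AE \<omega> in M. summable (\<lambda>k. a k * (y k \<omega> \<bullet> w k \<omega>))"
proof (rule mart_diff_AE_summable)
  note inner = noise_inner[OF w y(1,2)]
  have [measurable]: "w k \<in> borel_measurable M" for k using w measurable_F_M unfolding noise_def by blast
  have [measurable]: "y k \<in> borel_measurable M" for k using y(1) by (rule measurable_F_M)
  show "mart_diff (\<lambda>k \<omega>. a k * (y k \<omega> \<bullet> w k \<omega>))"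
    unfolding mart_diff_def
  proof (intro allI conjI)
    fix k
    have "w k \<in> borel_measurable (F (Suc k))" using w by (auto simp: noise_def)
    moreover have "y k \<in> borel_measurable (F (Suc k))" using y(1) by (rule measurable_F_mono[rotated]) simp
    ultimately show "(\<lambda>\<omega>. a k * (y k \<omega> \<bullet> w k \<omega>)) \<in> borel_measurable (F (Suc k))" by measurable
    show "integrable M (\<lambda>\<omega>. (a k * (y k \<omega> \<bullet> w k \<omega>))\<^sup>2)"
      using inner(2) by (simp add: power_mult_distrib)
    have "AE \<omega> in M. real_cond_exp M (F k) (\<lambda>\<omega>. a k * (y k \<omega> \<bullet> w k \<omega>)) \<omega>
        = a k * real_cond_exp M (F k) (\<lambda>\<omega>. y k \<omega> \<bullet> w k \<omega>) \<omega>"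
      using inner(1) by (rule sigma_finite_subalgebra.real_cond_exp_cmult[OF sigma_finite_F])
    with inner(4)[of k] show "AE \<omega> in M. real_cond_exp M (F k) (\<lambda>\<omega>. a k * (y k \<omega> \<bullet> w k \<omega>)) \<omega> = 0"
      by eventually_elim simp
  qed
  show "summable (\<lambda>k. expectation (\<lambda>\<omega>. (a k * (y k \<omega> \<bullet> w k \<omega>))\<^sup>2))"
  proof (rule summable_comparison_test'[OF summable_mult[OF a, of "\<nu>\<^sup>2 * K"]])
    fix k
    have "expectation (\<lambda>\<omega>. (y k \<omega> \<bullet> w k \<omega>)\<^sup>2) \<le> \<nu>\<^sup>2 * K"
      using inner(3)[of k] mult_left_mono[OF y(3)[of k], of "\<nu>\<^sup>2"] by simp
    then have "(a k)\<^sup>2 * expectation (\<lambda>\<omega>. (y k \<omega> \<bullet> w k \<omega>)\<^sup>2) \<le> (a k)\<^sup>2 * (\<nu>\<^sup>2 * K)"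
      by (intro mult_left_mono) auto
    then show "norm (expectation (\<lambda>\<omega>. (a k * (y k \<omega> \<bullet> w k \<omega>))\<^sup>2)) \<le> \<nu>\<^sup>2 * K * (a k)\<^sup>2"
      by (simp add: power_mult_distrib mult.commute)
  qed
qed

lemma noise_AE_summable_norm2:
  fixes w :: "nat \<Rightarrow> 'a \<Rightarrow> 'e::euclidean_space"
  assumes w: "noise w \<nu>" and a: "summable (\<lambda>k. (a k)\<^sup>2)"
  shows "AE \<omega> in M. summable (\<lambda>k. (a k)\<^sup>2 * (norm (w k \<omega>))\<^sup>2)"
proof (rule AE_summable_expectation)
  note w2 = noise_norm2[OF w]
  show "integrable M (\<lambda>\<omega>. (a k)\<^sup>2 * (norm (w k \<omega>))\<^sup>2)" for k using w2 by simp
  show "summable (\<lambda>k. expectation (\<lambda>\<omega>. (a k)\<^sup>2 * (norm (w k \<omega>))\<^sup>2))"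
  proof (rule summable_comparison_test'[OF summable_mult[OF a, of "\<nu>\<^sup>2"]])
    fix k
    show "norm (expectation (\<lambda>\<omega>. (a k)\<^sup>2 * (norm (w k \<omega>))\<^sup>2)) \<le> \<nu>\<^sup>2 * (a k)\<^sup>2"
      using mult_left_mono[OF w2(2)[of k], of "(a k)\<^sup>2"] by (simp add: mult.commute)
  qed
qed simp

text \<open>The initial point need not be square integrable. The \<open>F 0\<close>-measurable weight
  \<open>h = 1 / (1 + \<parallel>y\<^sub>0 - z\<parallel>\<^sup>2)\<close> makes \<open>h \<parallel>y\<^sub>k - z\<parallel>\<^sup>2\<close> integrable, and being positive it does not affect
  almost sure convergence.\<close>

theorem stochastic_projected_gradient_converges:
  fixes y v :: "nat \<Rightarrow> 'a \<Rightarrow> 'e::euclidean_space"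
  assumes S: "closed S" "convex S" "z \<in> S"
    and y_F: "\<And>k. y k \<in> borel_measurable (F k)" and yS: "\<And>k \<omega>. \<omega> \<in> space M \<Longrightarrow> y k \<omega> \<in> S"
    and step: "\<And>k \<omega>. \<omega> \<in> space M \<Longrightarrow>
        y (Suc k) \<omega> = closest_point S (y k \<omega> - \<gamma> k *\<^sub>R (G (y k \<omega>) + v k \<omega>))"
    and v: "noise v \<nu>"
    and mono: "\<And>x. x \<in> S \<Longrightarrow> \<mu> / 2 * (norm (x - z))\<^sup>2 \<le> G x \<bullet> (x - z)" and \<mu>: "0 < \<mu>"
    and growth: "\<And>x. x \<in> S \<Longrightarrow> (norm (G x))\<^sup>2 \<le> A + B * (norm (x - z))\<^sup>2" and AB: "0 \<le> A" "0 \<le> B"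
    and \<gamma>: "\<And>k. 0 < \<gamma> k" "\<not> summable \<gamma>" "summable (\<lambda>k. (\<gamma> k)\<^sup>2)"
  shows "AE \<omega> in M. (\<lambda>k. y k \<omega>) \<longlonglongrightarrow> z \<and> summable (\<lambda>k. \<gamma> k * (norm (y k \<omega> - z))\<^sup>2)"
proof -
  define u where "u k \<omega> = (norm (y k \<omega> - z))\<^sup>2" for k \<omega>
  define h where "h \<omega> = 1 / (1 + u 0 \<omega>)" for \<omega>
  define e where "e k \<omega> = h \<omega> *\<^sub>R (y k \<omega> - z)" for k \<omega>
  have u0: "0 \<le> u k \<omega>" for k \<omega> by (simp add: u_def)
  have h0: "0 < h \<omega>" and h1: "h \<omega> \<le> 1" for \<omega>
    using u0[of 0 \<omega>] by (auto simp: h_def)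
  have hu0: "0 \<le> h \<omega> * u k \<omega>" for k \<omega> using h0[of \<omega>] u0[of k \<omega>] by simp
  have y_F': "y j \<in> borel_measurable (F k)" if "j \<le> k" for j k
    using y_F that measurable_F_mono by blast
  have e_F: "e k \<in> borel_measurable (F k)" for k
  proof -
    note [measurable] = y_F'[of 0 k] y_F[of k]
    show ?thesis unfolding e_def h_def u_def by simp
  qed
  have [measurable]: "y k \<in> borel_measurable M" "v k \<in> borel_measurable M" "e k \<in> borel_measurable M" for k
    using y_F[of k] v e_F[of k] measurable_F_M unfolding noise_def by blast+
  then have [measurable]: "u k \<in> borel_measurable M" "h \<in> borel_measurable M" for k
    unfolding u_def h_def by measurable
  have e2: "(norm (e k \<omega>))\<^sup>2 \<le> h \<omega> * u k \<omega>" for k \<omega>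
  proof -
    have "(norm (e k \<omega>))\<^sup>2 = h \<omega> * (h \<omega> * u k \<omega>)"
      by (simp add: e_def u_def power2_eq_square)
    also have "\<dots> \<le> h \<omega> * u k \<omega>" using h0[of \<omega>] h1[of \<omega>] hu0[of \<omega> k] by (intro mult_left_le_one_le) auto
    finally show ?thesis .
  qed
  \<comment> \<open>Everything in the weighted descent except the contraction term. The weight is
    kept in the noise product and in the growth term, where it is needed for integrability, and
    bounded by 1 in the other two.\<close>
  define c where "c k \<omega> = - 2 * (\<gamma> k * (e k \<omega> \<bullet> v k \<omega>))
      + 2 * A * (\<gamma> k)\<^sup>2 + 2 * B * ((\<gamma> k)\<^sup>2 * (h \<omega> * u k \<omega>)) + 2 * ((\<gamma> k)\<^sup>2 * (norm (v k \<omega>))\<^sup>2)" for k \<omega>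
  have descent: "h \<omega> * u (Suc k) \<omega> \<le> h \<omega> * u k \<omega> - \<mu> * (\<gamma> k * (h \<omega> * u k \<omega>)) + c k \<omega>"
    if \<omega>: "\<omega> \<in> space M" for k \<omega>
  proof -
    let ?d = "G (y k \<omega>)" and ?e = "y k \<omega> - z"
    have "\<gamma> k * (\<mu> / 2 * u k \<omega>) \<le> \<gamma> k * (?d \<bullet> ?e)"
      using mono[OF yS[OF \<omega>]] \<gamma>(1)[of k] by (simp add: u_def)
    moreover have "(\<gamma> k)\<^sup>2 * (norm ?d)\<^sup>2 \<le> (\<gamma> k)\<^sup>2 * (A + B * u k \<omega>)"
      using growth[OF yS[OF \<omega>]] by (intro mult_left_mono) (simp_all add: u_def)
    ultimately have "u (Suc k) \<omega> \<le> u k \<omega> - \<mu> * (\<gamma> k * u k \<omega>) - 2 * (\<gamma> k * (?e \<bullet> v k \<omega>))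
        + 2 * (\<gamma> k)\<^sup>2 * (B * u k \<omega>) + 2 * (\<gamma> k)\<^sup>2 * (A + (norm (v k \<omega>))\<^sup>2)"
      using closest_point_step[OF S, of "y k \<omega>" "\<gamma> k" ?d "v k \<omega>"]
      unfolding step[OF \<omega>, symmetric] u_def by (simp add: inner_commute algebra_simps)
    then have "h \<omega> * u (Suc k) \<omega> \<le> h \<omega> * (u k \<omega> - \<mu> * (\<gamma> k * u k \<omega>) - 2 * (\<gamma> k * (?e \<bullet> v k \<omega>))
        + 2 * (\<gamma> k)\<^sup>2 * (B * u k \<omega>) + 2 * (\<gamma> k)\<^sup>2 * (A + (norm (v k \<omega>))\<^sup>2))"
      using h0[of \<omega>] by simp
    also have "\<dots> = h \<omega> * u k \<omega> - \<mu> * (\<gamma> k * (h \<omega> * u k \<omega>)) - 2 * (\<gamma> k * (e k \<omega> \<bullet> v k \<omega>))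
        + 2 * B * ((\<gamma> k)\<^sup>2 * (h \<omega> * u k \<omega>)) + h \<omega> * (2 * (\<gamma> k)\<^sup>2 * (A + (norm (v k \<omega>))\<^sup>2))"
      by (simp add: e_def algebra_simps)
    also have "h \<omega> * (2 * (\<gamma> k)\<^sup>2 * (A + (norm (v k \<omega>))\<^sup>2)) \<le> 2 * (\<gamma> k)\<^sup>2 * (A + (norm (v k \<omega>))\<^sup>2)"
      using h0[of \<omega>] h1[of \<omega>] AB by (intro mult_left_le_one_le) auto
    finally show ?thesis by (simp add: c_def algebra_simps)
  qed
  have v2: "integrable M (\<lambda>\<omega>. (norm (v k \<omega>))\<^sup>2)" "expectation (\<lambda>\<omega>. (norm (v k \<omega>))\<^sup>2) \<le> \<nu>\<^sup>2" for k
    using noise_norm2[OF v] by auto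
  have e2_int: "integrable M (\<lambda>\<omega>. (norm (e k \<omega>))\<^sup>2)" if "integrable M (\<lambda>\<omega>. h \<omega> * u k \<omega>)" for k
    by (rule Bochner_Integration.integrable_bound[OF that]) (use e2 hu0 in auto)
  \<comment> \<open>Integrability must be carried along with the recursion: only once
    \<open>h * u k\<close> is integrable does the noise product have mean zero, and then the next
    term is integrable too.\<close>
  have int_step: "integrable M (\<lambda>\<omega>. h \<omega> * u (Suc k) \<omega>)"
    "expectation (\<lambda>\<omega>. h \<omega> * u (Suc k) \<omega>)
      \<le> (1 + 2 * B * (\<gamma> k)\<^sup>2) * expectation (\<lambda>\<omega>. h \<omega> * u k \<omega>) + 2 * (A + \<nu>\<^sup>2) * (\<gamma> k)\<^sup>2"
    if int: "integrable M (\<lambda>\<omega>. h \<omega> * u k \<omega>)" for k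
  proof -
    note inner = noise_inner[OF v e_F e2_int[OF int]]
    have le: "h \<omega> * u (Suc k) \<omega> \<le> h \<omega> * u k \<omega> + c k \<omega>" if "\<omega> \<in> space M" for \<omega>
    proof -
      have "0 \<le> \<mu> * (\<gamma> k * (h \<omega> * u k \<omega>))" using \<mu> \<gamma>(1)[of k] hu0[of \<omega> k] by simp
      with descent[OF that, of k] show ?thesis by linarith
    qed
    have rhs: "integrable M (\<lambda>\<omega>. h \<omega> * u k \<omega> + c k \<omega>)"
      unfolding c_def using int inner(1) v2(1)[of k] by simp
    show int': "integrable M (\<lambda>\<omega>. h \<omega> * u (Suc k) \<omega>)"
    proof (rule Bochner_Integration.integrable_bound[OF rhs])
      show "AE \<omega> in M. norm (h \<omega> * u (Suc k) \<omega>) \<le> norm (h \<omega> * u k \<omega> + c k \<omega>)"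
      proof (rule AE_I2)
        fix \<omega> assume "\<omega> \<in> space M"
        from le[OF this] hu0[of \<omega> "Suc k"]
        show "norm (h \<omega> * u (Suc k) \<omega>) \<le> norm (h \<omega> * u k \<omega> + c k \<omega>)" unfolding real_norm_def by linarith
      qed
    qed measurable
    have "expectation (\<lambda>\<omega>. h \<omega> * u (Suc k) \<omega>) \<le> expectation (\<lambda>\<omega>. h \<omega> * u k \<omega> + c k \<omega>)"
      by (rule integral_mono[OF int' rhs le])
    also have "\<dots> = (1 + 2 * B * (\<gamma> k)\<^sup>2) * expectation (\<lambda>\<omega>. h \<omega> * u k \<omega>) + 2 * A * (\<gamma> k)\<^sup>2
        + 2 * (\<gamma> k)\<^sup>2 * expectation (\<lambda>\<omega>. (norm (v k \<omega>))\<^sup>2)"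
    proof -
      have "expectation (\<lambda>\<omega>. h \<omega> * u k \<omega> + c k \<omega>) = expectation (\<lambda>\<omega>. h \<omega> * u k \<omega>)
          + (- 2 * (\<gamma> k * expectation (\<lambda>\<omega>. e k \<omega> \<bullet> v k \<omega>)) + 2 * A * (\<gamma> k)\<^sup>2
            + 2 * B * ((\<gamma> k)\<^sup>2 * expectation (\<lambda>\<omega>. h \<omega> * u k \<omega>))
            + 2 * ((\<gamma> k)\<^sup>2 * expectation (\<lambda>\<omega>. (norm (v k \<omega>))\<^sup>2)))"
        unfolding c_def using int inner(1) v2(1)[of k] by (simp add: prob_space)
      then show ?thesis unfolding inner(5) by (simp add: algebra_simps)
    qed
    also have "2 * (\<gamma> k)\<^sup>2 * expectation (\<lambda>\<omega>. (norm (v k \<omega>))\<^sup>2) \<le> 2 * (\<gamma> k)\<^sup>2 * \<nu>\<^sup>2"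
      using v2(2)[of k] by (intro mult_left_mono) auto
    finally show "expectation (\<lambda>\<omega>. h \<omega> * u (Suc k) \<omega>)
      \<le> (1 + 2 * B * (\<gamma> k)\<^sup>2) * expectation (\<lambda>\<omega>. h \<omega> * u k \<omega>) + 2 * (A + \<nu>\<^sup>2) * (\<gamma> k)\<^sup>2"
      by (simp add: algebra_simps)
  qed
  have hu_int: "integrable M (\<lambda>\<omega>. h \<omega> * u k \<omega>)" for k
  proof (induction k)
    case 0
    \<comment> \<open>Here the choice of weight pays off: the initial term is
      \<open>u 0 / (1 + u 0)\<close>.\<close>
    have "h \<omega> * u 0 \<omega> \<le> 1" for \<omega> using u0[of 0 \<omega>] by (simp add: h_def)
    then show ?case using hu0[of _ 0] by (intro integrable_const_bound[where B = 1]) auto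
  qed (rule int_step(1))
  obtain K where K: "\<And>k. expectation (\<lambda>\<omega>. h \<omega> * u k \<omega>) \<le> K"
  proof (rule perturbed_recursion_bounded)
    show "expectation (\<lambda>\<omega>. h \<omega> * u (Suc k) \<omega>)
      \<le> (1 + 2 * B * (\<gamma> k)\<^sup>2) * expectation (\<lambda>\<omega>. h \<omega> * u k \<omega>) + 2 * (A + \<nu>\<^sup>2) * (\<gamma> k)\<^sup>2" for k
      by (rule int_step(2)[OF hu_int])
    show "0 \<le> expectation (\<lambda>\<omega>. h \<omega> * u k \<omega>)" for k using hu0 by (intro Bochner_Integration.integral_nonneg) auto
  qed (use AB \<gamma>(3) in \<open>auto intro: summable_mult\<close>)
  have "AE \<omega> in M. summable (\<lambda>k. \<gamma> k * (e k \<omega> \<bullet> v k \<omega>))"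
  proof (rule noise_AE_summable_inner[OF v e_F e2_int[OF hu_int] _ \<gamma>(3)])
    show "expectation (\<lambda>\<omega>. (norm (e k \<omega>))\<^sup>2) \<le> K" for k
      using integral_mono[OF e2_int[OF hu_int] hu_int e2, of k] K[of k] by linarith
  qed
  moreover have "AE \<omega> in M. summable (\<lambda>k. (\<gamma> k)\<^sup>2 * (norm (v k \<omega>))\<^sup>2)"
    by (rule noise_AE_summable_norm2[OF v \<gamma>(3)])
  moreover have "AE \<omega> in M. summable (\<lambda>k. (\<gamma> k)\<^sup>2 * (h \<omega> * u k \<omega>))"
  proof (rule AE_summable_expectation)
    show "summable (\<lambda>k. expectation (\<lambda>\<omega>. (\<gamma> k)\<^sup>2 * (h \<omega> * u k \<omega>)))"
    proof (rule summable_comparison_test'[OF summable_mult[OF \<gamma>(3), of K]])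
      fix k
      have "0 \<le> expectation (\<lambda>\<omega>. h \<omega> * u k \<omega>)" using hu0 by (intro Bochner_Integration.integral_nonneg) auto
      then show "norm (expectation (\<lambda>\<omega>. (\<gamma> k)\<^sup>2 * (h \<omega> * u k \<omega>))) \<le> K * (\<gamma> k)\<^sup>2"
        using mult_left_mono[OF K[of k], of "(\<gamma> k)\<^sup>2"] by (simp add: abs_mult mult.commute)
    qed
  qed (use hu_int hu0 in auto)
  ultimately show ?thesis
    using AE_space
  proof eventually_elim
    case (elim \<omega>)
    have c: "summable (\<lambda>k. c k \<omega>)"
      unfolding c_def by (intro summable_add summable_mult elim \<gamma>(3))
    have b: "0 \<le> \<mu> * (\<gamma> k * (h \<omega> * u k \<omega>))" for k using \<mu> \<gamma>(1)[of k] hu0[of \<omega> k] by simp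
    note pd = perturbed_descent[of "\<lambda>k. h \<omega> * u k \<omega>", OF descent[OF elim(4)] hu0 b c]
    \<comment> \<open>Along a fixed path \<open>h\<close> is a positive constant, so it can be
      divided out.\<close>
    have "summable (\<lambda>k. 1 / (\<mu> * h \<omega>) * (\<mu> * (\<gamma> k * (h \<omega> * u k \<omega>))))" by (rule summable_mult[OF pd(2)])
    then have sm: "summable (\<lambda>k. \<gamma> k * u k \<omega>)" using \<mu> h0[of \<omega>] by simp
    have "convergent (\<lambda>k. 1 / h \<omega> * (h \<omega> * u k \<omega>))"
      using pd(1) convergent_mult[OF convergent_const] by blast
    then have "convergent (\<lambda>k. u k \<omega>)" using h0[of \<omega>] by simp
    then have "(\<lambda>k. u k \<omega>) \<longlonglongrightarrow> 0"
      by (rule convergent_summable_mult_tendsto_0[OF _ u0 sm \<gamma>(2,1)])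
    from tendsto_real_sqrt[OF this] have "(\<lambda>k. norm (y k \<omega> - z)) \<longlonglongrightarrow> 0" by (simp add: u_def)
    then have "(\<lambda>k. y k \<omega>) \<longlonglongrightarrow> z" by (rule LIM_zero_cancel[OF tendsto_norm_zero_cancel])
    with sm show ?case by (simp add: u_def)
  qed
qed

end

section \<open>The coupled scheme\<close>

lemma rv_events_subset_sets:
  assumes "Z \<in> borel_measurable M"
  shows "rv_events M Z \<subseteq> sets M"
  using assms by (auto simp: rv_events_def)

lemma borel_measurable_sigma_rv_events:
  assumes "rv_events M Z \<subseteq> E" "E \<subseteq> Pow (space M)"
  shows "Z \<in> borel_measurable (sigma (space M) E)"
  using assms by (intro measurableI) (auto simp: rv_events_def)

lemma
  assumes meas: "x0 \<in> borel_measurable M" "y0 \<in> borel_measurable M"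
    "\<And>k. w k \<in> borel_measurable M" "\<And>k. v k \<in> borel_measurable M"
  shows subalgebra_gen_filtration: "subalgebra M (gen_filtration M x0 y0 w v k)"
    and gen_filtration_mono: "j \<le> k \<Longrightarrow> subalgebra (gen_filtration M x0 y0 w v k) (gen_filtration M x0 y0 w v j)"
    and gen_filtration_initial: "x0 \<in> borel_measurable (gen_filtration M x0 y0 w v k)"
      "y0 \<in> borel_measurable (gen_filtration M x0 y0 w v k)"
    and gen_filtration_noise: "j < k \<Longrightarrow> w j \<in> borel_measurable (gen_filtration M x0 y0 w v k)"
      "j < k \<Longrightarrow> v j \<in> borel_measurable (gen_filtration M x0 y0 w v k)"
proof -
  define E where "E k = rv_events M x0 \<union> rv_events M y0 \<union> (\<Union>l<k. rv_events M (w l) \<union> rv_events M (v l))" for k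
  have F: "gen_filtration M x0 y0 w v k = sigma (space M) (E k)" for k
    by (simp add: gen_filtration_def E_def)
  have E: "E k \<subseteq> sets M" for k
    using meas[THEN rv_events_subset_sets] unfolding E_def by blast
  then have EP: "E k \<subseteq> Pow (space M)" for k using sets.sets_into_space by blast
  show "subalgebra M (gen_filtration M x0 y0 w v k)"
    unfolding F subalgebra_def using E[of k] EP[of k] by (simp add: sets.sigma_sets_subset)
  show "subalgebra (gen_filtration M x0 y0 w v k) (gen_filtration M x0 y0 w v j)" if "j \<le> k"
  proof -
    have "E j \<subseteq> E k" using that unfolding E_def by fastforce
    then show ?thesis unfolding F subalgebra_def using EP by (simp add: sigma_sets_mono')
  qed
  show "x0 \<in> borel_measurable (gen_filtration M x0 y0 w v k)" "y0 \<in> borel_measurable (gen_filtration M x0 y0 w v k)"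
    unfolding F using EP[of k] by (auto intro!: borel_measurable_sigma_rv_events simp: E_def)
  show "w j \<in> borel_measurable (gen_filtration M x0 y0 w v k)" "v j \<in> borel_measurable (gen_filtration M x0 y0 w v k)"
    if "j < k"
    unfolding F using that by (intro borel_measurable_sigma_rv_events[OF _ EP], force simp: E_def)+
qed

text \<open>Each Lipschitz constant is uniform in the other variable, so an increment can be split
  into one move per variable. Joint continuity is what makes the gradient at the random pair of
  iterates measurable.\<close>

lemma continuous_on_Times_Lipschitz:
  fixes G :: "'a::real_normed_vector \<Rightarrow> 'b::real_normed_vector \<Rightarrow> 'c::real_normed_vector"
  assumes "\<And>x x' y. x \<in> X \<Longrightarrow> x' \<in> X \<Longrightarrow> y \<in> Y \<Longrightarrow> norm (G x y - G x' y) \<le> L * norm (x - x')"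
    and "\<And>x y y'. x \<in> X \<Longrightarrow> y \<in> Y \<Longrightarrow> y' \<in> Y \<Longrightarrow> norm (G x y - G x y') \<le> K * norm (y - y')"
  shows "continuous_on (X \<times> Y) (\<lambda>p. G (fst p) (snd p))"
  unfolding continuous_on_def
proof (intro ballI)
  fix p assume p: "p \<in> X \<times> Y"
  have "norm (G (fst q) (snd q) - G (fst p) (snd p)) \<le> L * norm (fst q - fst p) + K * norm (snd q - snd p)"
    if "q \<in> X \<times> Y" for q
  proof -
    have "norm (G (fst q) (snd q) - G (fst p) (snd p))
        \<le> norm (G (fst q) (snd q) - G (fst p) (snd q)) + norm (G (fst p) (snd q) - G (fst p) (snd p))"
      using norm_triangle_ineq[of "G (fst q) (snd q) - G (fst p) (snd q)" "G (fst p) (snd q) - G (fst p) (snd p)"]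
      by simp
    moreover have "norm (G (fst q) (snd q) - G (fst p) (snd q)) \<le> L * norm (fst q - fst p)"
      using assms(1) p that by auto
    moreover have "norm (G (fst p) (snd q) - G (fst p) (snd p)) \<le> K * norm (snd q - snd p)"
      using assms(2) p that by auto
    ultimately show ?thesis by linarith
  qed
  then have bound: "\<forall>\<^sub>F q in at p within X \<times> Y. norm (G (fst q) (snd q) - G (fst p) (snd p))
      \<le> L * norm (fst q - fst p) + K * norm (snd q - snd p)"
    unfolding eventually_at_filter by (intro always_eventually) blast
  have "((\<lambda>q. L * norm (fst q - fst p) + K * norm (snd q - snd p))
      \<longlongrightarrow> L * norm (fst p - fst p) + K * norm (snd p - snd p)) (at p within X \<times> Y)"
    by (intro tendsto_intros)
  then have "((\<lambda>q. L * norm (fst q - fst p) + K * norm (snd q - snd p)) \<longlongrightarrow> 0) (at p within X \<times> Y)" by simp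
  from Lim_null_comparison[OF bound this]
  show "((\<lambda>q. G (fst q) (snd q)) \<longlongrightarrow> G (fst p) (snd p)) (at p within X \<times> Y)" by (rule LIM_zero_cancel)
qed

text \<open>The gradients are controlled only on the feasible sets, so the composition goes through
  the restricted Borel space.\<close>

lemma borel_measurable_continuous_on_compose:
  assumes "continuous_on S G" "h \<in> borel_measurable N" "\<And>\<omega>. \<omega> \<in> space N \<Longrightarrow> h \<omega> \<in> S"
  shows "(\<lambda>\<omega>. G (h \<omega>)) \<in> borel_measurable N"
proof -
  have "h \<in> measurable N (restrict_space borel S)"
    using assms(2,3) by (intro measurable_restrict_space2) auto
  from measurable_compose[OF this borel_measurable_continuous_on_restrict[OF assms(1)]] show ?thesis .
qed

theorem theorem2p6:
  fixes M :: "'a measure"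
    and X :: "'x::euclidean_space set" and \<Theta> :: "'t::euclidean_space set"
    and f :: "'x \<Rightarrow> 't \<Rightarrow> real" and gradf :: "'x \<Rightarrow> 't \<Rightarrow> 'x"
    and g :: "'t \<Rightarrow> real" and gradg :: "'t \<Rightarrow> 't"
    and xs :: "nat \<Rightarrow> 'a \<Rightarrow> 'x" and ths :: "nat \<Rightarrow> 'a \<Rightarrow> 't"
    and w :: "nat \<Rightarrow> 'a \<Rightarrow> 'x" and v :: "nat \<Rightarrow> 'a \<Rightarrow> 't"
    and \<gamma>x \<gamma>\<theta> :: "nat \<Rightarrow> real"
    and Lx L\<theta> \<mu> C\<theta> \<tau> \<nu>x \<nu>\<theta> :: real
    and thstar :: 't
  assumes M: "prob_space M"
    and X: "closed X" "convex X" "X \<noteq> {}"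
    and \<Theta>: "closed \<Theta>" "convex \<Theta>" "\<Theta> \<noteq> {}"
    \<comment> \<open>random initial point and random noise vectors\<close>
    and x0_meas: "xs 0 \<in> borel_measurable M" and th0_meas: "ths 0 \<in> borel_measurable M"
    and x0_in: "\<forall>\<omega>\<in>space M. xs 0 \<omega> \<in> X" and th0_in: "\<forall>\<omega>\<in>space M. ths 0 \<omega> \<in> \<Theta>"
    and w_meas: "\<And>k. w k \<in> borel_measurable M" and v_meas: "\<And>k. v k \<in> borel_measurable M"
    \<comment> \<open>the coupled projected scheme\<close>
    and step_pos: "\<And>k. \<gamma>x k > 0" "\<And>k. \<gamma>\<theta> k > 0"
    and x_step: "\<And>k \<omega>. \<omega> \<in> space M \<Longrightarrow>
        xs (Suc k) \<omega> = closest_point X (xs k \<omega> - \<gamma>x k *\<^sub>R (gradf (xs k \<omega>) (ths k \<omega>) + w k \<omega>))"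
    and th_step: "\<And>k \<omega>. \<omega> \<in> space M \<Longrightarrow>
        ths (Suc k) \<omega> = closest_point \<Theta> (ths k \<omega> - \<gamma>\<theta> k *\<^sub>R (gradg (ths k \<omega>) + v k \<omega>))"
    \<comment> \<open>(A1-2)\<close>
    and f_convex: "\<And>\<theta>. \<theta> \<in> \<Theta> \<Longrightarrow> convex_on X (\<lambda>x. f x \<theta>)"
    and f_diff: "\<And>\<theta> x. \<theta> \<in> \<Theta> \<Longrightarrow> x \<in> X \<Longrightarrow>
        ((\<lambda>x. f x \<theta>) has_derivative (\<lambda>h. gradf x \<theta> \<bullet> h)) (at x)"
    and f_C1: "\<And>\<theta>. \<theta> \<in> \<Theta> \<Longrightarrow> continuous_on X (\<lambda>x. gradf x \<theta>)"
    and f_Lx: "\<And>\<theta> x y. \<theta> \<in> \<Theta> \<Longrightarrow> x \<in> X \<Longrightarrow> y \<in> X \<Longrightarrow>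
        norm (gradf x \<theta> - gradf y \<theta>) \<le> Lx * norm (x - y)"
    and f_L\<theta>: "\<And>x \<theta>1 \<theta>2. x \<in> X \<Longrightarrow> \<theta>1 \<in> \<Theta> \<Longrightarrow> \<theta>2 \<in> \<Theta> \<Longrightarrow>
        norm (gradf x \<theta>1 - gradf x \<theta>2) \<le> L\<theta> * norm (\<theta>1 - \<theta>2)"
    and \<mu>_pos: "\<mu> > 0"
    and g_sconvex: "strongly_convex_on \<Theta> \<mu> g"
    and g_diff: "\<And>\<theta>. \<theta> \<in> \<Theta> \<Longrightarrow> (g has_derivative (\<lambda>h. gradg \<theta> \<bullet> h)) (at \<theta>)"
    and g_C1: "continuous_on \<Theta> gradg"
    and g_C\<theta>: "\<And>\<theta>1 \<theta>2. \<theta>1 \<in> \<Theta> \<Longrightarrow> \<theta>2 \<in> \<Theta> \<Longrightarrow>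
        norm (gradg \<theta>1 - gradg \<theta>2) \<le> C\<theta> * norm (\<theta>1 - \<theta>2)"
    \<comment> \<open>(A2-2)\<close>
    and \<tau>: "0 < \<tau>" "\<tau> < 1"
    and sum1: "summable (\<lambda>k. \<gamma>x k powr (2 - \<tau>))"
    and sum2: "summable (\<lambda>k. (\<gamma>\<theta> k)\<^sup>2)"
    and div1: "\<not> summable \<gamma>x"
    and div2: "\<not> summable \<gamma>\<theta>"
    and \<beta>_mono: "decseq (\<lambda>k. \<gamma>x k powr \<tau> / (2 * \<gamma>\<theta> k * \<mu>))"
    and \<beta>_lim: "(\<lambda>k. \<gamma>x k powr \<tau> / (2 * \<gamma>\<theta> k * \<mu>)) \<longlonglongrightarrow> 0"
    \<comment> \<open>(A3), with F_k generated by (x0, theta0) and (w^l, v^l), l < k\<close>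
    and A3: "AE \<omega> in M. \<forall>k.
        (\<forall>b\<in>Basis. real_cond_exp M (gen_filtration M (xs 0) (ths 0) w v k) (\<lambda>\<omega>. w k \<omega> \<bullet> b) \<omega> = 0) \<and>
        (\<forall>b\<in>Basis. real_cond_exp M (gen_filtration M (xs 0) (ths 0) w v k) (\<lambda>\<omega>. v k \<omega> \<bullet> b) \<omega> = 0) \<and>
        nn_cond_exp M (gen_filtration M (xs 0) (ths 0) w v k) (\<lambda>\<omega>. ennreal ((norm (w k \<omega>))\<^sup>2)) \<omega> \<le> ennreal (\<nu>x\<^sup>2) \<and>
        nn_cond_exp M (gen_filtration M (xs 0) (ths 0) w v k) (\<lambda>\<omega>. ennreal ((norm (v k \<omega>))\<^sup>2)) \<omega> \<le> ennreal (\<nu>\<theta>\<^sup>2)"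
    \<comment> \<open>additional hypotheses\<close>
    and X_bdd: "bounded X"
    and thstar: "thstar \<in> \<Theta>" "\<forall>\<theta>\<in>\<Theta>. g thstar \<le> g \<theta>"
    and Xstar_ne: "{x \<in> X. \<forall>y\<in>X. f x thstar \<le> f y thstar} \<noteq> {}"
  shows "(AE \<omega> in M. (\<lambda>k. ths k \<omega>) \<longlonglongrightarrow> thstar) \<and>
         (AE \<omega> in M. \<exists>xl \<in> {x \<in> X. \<forall>y\<in>X. f x thstar \<le> f y thstar}. (\<lambda>k. xs k \<omega>) \<longlonglongrightarrow> xl)"
proof -
  let ?F = "gen_filtration M (xs 0) (ths 0) w v"
  note F_initial = gen_filtration_initial[where w = w and v = v, OF x0_meas th0_meas w_meas v_meas]
    and F_noise = gen_filtration_noise[where w = w and v = v, OF x0_meas th0_meas w_meas v_meas]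
  interpret prob_space M by (rule M)
  interpret filtered_prob_space M ?F
  proof unfold_locales
    show "subalgebra M (?F k)" for k
      by (rule subalgebra_gen_filtration[OF x0_meas th0_meas w_meas v_meas])
    show "subalgebra (?F k) (?F j)" if "j \<le> k" for j k
      using that by (rule gen_filtration_mono[OF x0_meas th0_meas w_meas v_meas])
  qed
  have space_F: "space (?F k) = space M" for k using subalg[of k] by (simp add: subalgebra_def)
  have w: "noise w \<nu>x"
    unfolding noise_def
  proof (intro allI conjI ballI)
    fix k
    show "w k \<in> borel_measurable (?F (Suc k))" by (rule F_noise) simp
    show "AE \<omega> in M. nn_cond_exp M (?F k) (\<lambda>\<omega>. ennreal ((norm (w k \<omega>))\<^sup>2)) \<omega> \<le> ennreal (\<nu>x\<^sup>2)"
      using A3 by eventually_elim blast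
    show "AE \<omega> in M. real_cond_exp M (?F k) (\<lambda>\<omega>. w k \<omega> \<bullet> b) \<omega> = 0" if "b \<in> Basis" for b
      using A3 by eventually_elim (use that in blast)
  qed
  have v: "noise v \<nu>\<theta>"
    unfolding noise_def
  proof (intro allI conjI ballI)
    fix k
    show "v k \<in> borel_measurable (?F (Suc k))" by (rule F_noise) simp
    show "AE \<omega> in M. nn_cond_exp M (?F k) (\<lambda>\<omega>. ennreal ((norm (v k \<omega>))\<^sup>2)) \<omega> \<le> ennreal (\<nu>\<theta>\<^sup>2)"
      using A3 by eventually_elim blast
    show "AE \<omega> in M. real_cond_exp M (?F k) (\<lambda>\<omega>. v k \<omega> \<bullet> b) \<omega> = 0" if "b \<in> Basis" for b
      using A3 by eventually_elim (use that in blast)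
  qed
  have xX: "xs k \<omega> \<in> X" and th\<Theta>: "ths k \<omega> \<in> \<Theta>" if "\<omega> \<in> space M" for k \<omega>
    using that x0_in th0_in x_step th_step closest_point_in_set[OF X(1,3)] closest_point_in_set[OF \<Theta>(1,3)]
    by (cases k; simp)+
  have gradf_cont: "continuous_on (X \<times> \<Theta>) (\<lambda>p. gradf (fst p) (snd p))"
    using f_Lx f_L\<theta> by (rule continuous_on_Times_Lipschitz)
  have proj_meas: "closest_point S \<in> borel_measurable borel"
    if "closed S" "convex S" "S \<noteq> {}" for S :: "'e::euclidean_space set"
    using that by (intro borel_measurable_continuous_onI continuous_on_closest_point)
  have meas: "xs k \<in> borel_measurable (?F k) \<and> ths k \<in> borel_measurable (?F k)" for k
  proof (induction k)
    case 0 show ?case using F_initial by simp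
  next
    case (Suc k)
    have x[measurable]: "xs k \<in> borel_measurable (?F (Suc k))" and th[measurable]: "ths k \<in> borel_measurable (?F (Suc k))"
      using Suc measurable_F_mono[of k "Suc k"] by auto
    have [measurable]: "w k \<in> borel_measurable (?F (Suc k))" "v k \<in> borel_measurable (?F (Suc k))"
      using F_noise by auto
    have [measurable]: "(\<lambda>\<omega>. gradg (ths k \<omega>)) \<in> borel_measurable (?F (Suc k))"
      using th\<Theta> by (intro borel_measurable_continuous_on_compose[OF g_C1 th]) (simp add: space_F)
    have "(\<lambda>\<omega>. (xs k \<omega>, ths k \<omega>)) \<in> borel_measurable (?F (Suc k))" by measurable
    from borel_measurable_continuous_on_compose[OF gradf_cont this]
    have [measurable]: "(\<lambda>\<omega>. gradf (xs k \<omega>) (ths k \<omega>)) \<in> borel_measurable (?F (Suc k))"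
      using xX th\<Theta> by (simp add: space_F)
    have "(\<lambda>\<omega>. closest_point X (xs k \<omega> - \<gamma>x k *\<^sub>R (gradf (xs k \<omega>) (ths k \<omega>) + w k \<omega>))) \<in> borel_measurable (?F (Suc k))"
      by (rule measurable_compose[OF _ proj_meas[OF X]]) measurable
    moreover have "(\<lambda>\<omega>. closest_point \<Theta> (ths k \<omega> - \<gamma>\<theta> k *\<^sub>R (gradg (ths k \<omega>) + v k \<omega>))) \<in> borel_measurable (?F (Suc k))"
      by (rule measurable_compose[OF _ proj_meas[OF \<Theta>]]) measurable
    ultimately show ?case
      using measurable_cong[of "?F (Suc k)" "xs (Suc k)", OF x_step] measurable_cong[of "?F (Suc k)" "ths (Suc k)", OF th_step]
      by (simp add: space_F)
  qed
  have th_AE: "AE \<omega> in M. (\<lambda>k. ths k \<omega>) \<longlonglongrightarrow> thstar \<and> summable (\<lambda>k. \<gamma>\<theta> k * (norm (ths k \<omega> - thstar))\<^sup>2)"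
  proof (rule stochastic_projected_gradient_converges[OF \<Theta>(1,2) thstar(1) _ th\<Theta> th_step v _ \<mu>_pos _ _ _ step_pos(2) div2 sum2])
    fix \<theta> assume \<theta>: "\<theta> \<in> \<Theta>"
    \<comment> \<open>Strong convexity at \<open>\<theta>\<close> is combined with
      \<open>g thstar \<le> g \<theta>\<close> alone, which gives the constant
      \<open>\<mu> / 2\<close>.\<close>
    show "\<mu> / 2 * (norm (\<theta> - thstar))\<^sup>2 \<le> gradg \<theta> \<bullet> (\<theta> - thstar)"
      using strongly_convex_on_gradient_le[OF g_sconvex g_diff[OF \<theta>] \<theta> thstar(1)] thstar(2) \<theta>
      by (fastforce simp: inner_diff_right)
    have "(norm (gradg \<theta> - gradg thstar))\<^sup>2 \<le> (C\<theta> * norm (\<theta> - thstar))\<^sup>2"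
      using g_C\<theta>[OF \<theta> thstar(1)] by (intro power_mono) auto
    \<comment> \<open>The right side minus the left is the squared norm of
      \<open>2 *\<^sub>R gradg thstar - gradg \<theta>\<close>.\<close>
    moreover have "(norm (gradg \<theta>))\<^sup>2 \<le> 2 * (norm (gradg thstar))\<^sup>2 + 2 * (norm (gradg \<theta> - gradg thstar))\<^sup>2"
      using inner_ge_zero[of "2 *\<^sub>R gradg thstar - gradg \<theta>"] unfolding power2_norm_eq_inner
      by (simp add: inner_diff inner_commute algebra_simps)
    ultimately show "(norm (gradg \<theta>))\<^sup>2 \<le> 2 * (norm (gradg thstar))\<^sup>2 + 2 * C\<theta>\<^sup>2 * (norm (\<theta> - thstar))\<^sup>2"
      by (simp add: power_mult_distrib)
  qed (use meas in auto)
  \<comment> \<open>The summable powers tend to 0, so eventually \<open>\<gamma>x k \<le> 1\<close>,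
    and then the larger exponent 2 gives the smaller power.\<close>
  have \<gamma>x2: "summable (\<lambda>k. (\<gamma>x k)\<^sup>2)"
  proof (rule summable_comparison_test_ev[OF _ sum1])
    have "(\<lambda>k. \<gamma>x k powr (2 - \<tau>)) \<longlonglongrightarrow> 0" by (rule summable_LIMSEQ_zero[OF sum1])
    then have "\<forall>\<^sub>F k in sequentially. \<gamma>x k powr (2 - \<tau>) < 1" by (rule order_tendstoD) simp
    then show "\<forall>\<^sub>F k in sequentially. norm ((\<gamma>x k)\<^sup>2) \<le> \<gamma>x k powr (2 - \<tau>)"
    proof eventually_elim
      case (elim k)
      have "\<gamma>x k \<le> 1"
      proof (rule ccontr)
        assume "\<not> \<gamma>x k \<le> 1"
        then have "1 \<le> \<gamma>x k powr (2 - \<tau>)" using \<tau> by (intro ge_one_powr_ge_zero) auto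
        with elim show False by simp
      qed
      then have "\<gamma>x k powr 2 \<le> \<gamma>x k powr (2 - \<tau>)" using \<tau> step_pos(1)[of k] by (intro powr_mono') auto
      then show ?case using step_pos(1)[of k] by simp
    qed
  qed
  obtain D where D: "\<And>x. x \<in> X \<Longrightarrow> norm x \<le> D" using X_bdd by (auto simp: bounded_iff)
  have xM: "xs k \<in> borel_measurable M" for k using meas measurable_F_M by blast
  have x2: "(norm (xs k \<omega>))\<^sup>2 \<le> D\<^sup>2" if "\<omega> \<in> space M" for k \<omega>
    using D[OF xX[OF that]] by (intro power_mono) auto
  have x2_int: "integrable M (\<lambda>\<omega>. (norm (xs k \<omega>))\<^sup>2)" for k
    using x2 xM by (intro integrable_const_bound[where B = "D\<^sup>2"]) auto
  have "AE \<omega> in M. summable (\<lambda>k. \<gamma>x k * (xs k \<omega> \<bullet> w k \<omega>))"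
  proof (rule noise_AE_summable_inner[OF w _ x2_int _ \<gamma>x2])
    show "expectation (\<lambda>\<omega>. (norm (xs k \<omega>))\<^sup>2) \<le> D\<^sup>2" for k
      using integral_mono[OF x2_int integrable_const x2, of k] by (simp add: prob_space)
  qed (use meas in auto)
  moreover have "AE \<omega> in M. \<forall>b\<in>Basis. summable (\<lambda>k. \<gamma>x k * (b \<bullet> w k \<omega>))"
  proof (rule AE_finite_allI)
    fix b :: 'x
    show "AE \<omega> in M. summable (\<lambda>k. \<gamma>x k * (b \<bullet> w k \<omega>))"
      by (rule noise_AE_summable_inner[OF w _ _ _ \<gamma>x2, where K = "(norm b)\<^sup>2"]) (auto simp: prob_space)
  qed simp
  moreover have "AE \<omega> in M. summable (\<lambda>k. (\<gamma>x k)\<^sup>2 * (norm (w k \<omega>))\<^sup>2)"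
    by (rule noise_AE_summable_norm2[OF w \<gamma>x2])
  ultimately have "AE \<omega> in M. \<exists>xl \<in> {x \<in> X. \<forall>y\<in>X. f x thstar \<le> f y thstar}. (\<lambda>k. xs k \<omega>) \<longlonglongrightarrow> xl"
    using th_AE AE_space
  proof eventually_elim
    case (elim \<omega>)
    \<comment> \<open>The error of using the current parameter in place of \<open>thstar\<close>; it
      plays the role of the perturbation \<open>r\<close> in the pathwise theorem.\<close>
    let ?r = "\<lambda>k. gradf (xs k \<omega>) (ths k \<omega>) - gradf (xs k \<omega>) thstar"
    have "summable (\<lambda>k. \<gamma>x k * norm (?r k))"
    proof (rule summable_comparison_test')
      let ?\<beta> = "\<lambda>k. \<gamma>x k powr \<tau> / (2 * \<gamma>\<theta> k * \<mu>)"
      \<comment> \<open>The majorant joins the given series of powers with the weighted squared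
        errors of the parameter. Monotonicity of the ratio supplies the uniform constant
        \<open>?\<beta> 0\<close>; the absolute value is taken because \<open>L\<theta>\<close> has
        no prescribed sign.\<close>
      let ?s = "\<lambda>k. \<bar>L\<theta>\<bar> * (\<gamma>x k powr (2 - \<tau>) + 2 * \<mu> * ?\<beta> 0 * (\<gamma>\<theta> k * (norm (ths k \<omega> - thstar))\<^sup>2))"
      show "summable ?s" using elim sum1 by (intro summable_mult summable_add) auto
      fix k
      let ?n = "norm (ths k \<omega> - thstar)"
      have "?\<beta> k \<le> ?\<beta> 0" using decseqD[OF \<beta>_mono, of 0 k] by simp
      then have "\<gamma>x k powr \<tau> \<le> ?\<beta> 0 * (2 * \<gamma>\<theta> k * \<mu>)"
        using step_pos(2)[of k] \<mu>_pos by (subst (asm) pos_divide_le_eq) auto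
      from mult_right_mono[OF this, of "?n\<^sup>2"]
      have \<beta>: "\<gamma>x k powr \<tau> * ?n\<^sup>2 \<le> 2 * \<mu> * ?\<beta> 0 * (\<gamma>\<theta> k * ?n\<^sup>2)" by (simp only: mult_ac zero_le_power2)
      \<comment> \<open>AM-GM, splitting \<open>\<gamma> = \<gamma>\<^bsup>1 - \<tau>/2\<^esup> \<gamma>\<^bsup>\<tau>/2\<^esup>\<close>\<close>
      have "\<gamma>x k * ?n = \<gamma>x k powr (1 - \<tau> / 2) * (\<gamma>x k powr (\<tau> / 2) * ?n)"
        using step_pos(1)[of k] by (simp add: powr_add[symmetric] flip: mult.assoc)
      also have "2 * \<dots> \<le> (\<gamma>x k powr (1 - \<tau> / 2))\<^sup>2 + (\<gamma>x k powr (\<tau> / 2) * ?n)\<^sup>2"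
        using sum_squares_bound by (simp add: mult.assoc)
      also have "\<dots> = \<gamma>x k powr (2 - \<tau>) + \<gamma>x k powr \<tau> * ?n\<^sup>2"
        by (simp add: power_mult_distrib power2_eq_square flip: powr_add)
      finally have "\<gamma>x k * ?n \<le> \<gamma>x k powr (2 - \<tau>) + 2 * \<mu> * ?\<beta> 0 * (\<gamma>\<theta> k * ?n\<^sup>2)"
        using \<beta> mult_nonneg_nonneg[OF less_imp_le[OF step_pos(1)[of k]] norm_ge_zero[of "ths k \<omega> - thstar"]]
        by linarith
      then have "\<bar>L\<theta>\<bar> * (\<gamma>x k * ?n) \<le> ?s k" by (intro mult_left_mono) auto
      moreover have "norm (?r k) \<le> \<bar>L\<theta>\<bar> * ?n"
        using f_L\<theta>[OF xX th\<Theta> thstar(1), OF elim(5,5), of k k] mult_right_mono[OF abs_ge_self, of ?n L\<theta>] by simp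
      then have "\<gamma>x k * norm (?r k) \<le> \<bar>L\<theta>\<bar> * (\<gamma>x k * ?n)"
        using mult_left_mono[of "norm (?r k)" _ "\<gamma>x k"] step_pos(1)[of k] by (simp add: mult_ac)
      moreover have "norm (\<gamma>x k * norm (?r k)) = \<gamma>x k * norm (?r k)"
        using step_pos(1)[of k] by (simp add: abs_mult)
      ultimately show "norm (\<gamma>x k * norm (?r k)) \<le> ?s k" by linarith
    qed
    note r = this
    show ?case
    proof (rule projected_gradient_converges[where x = "\<lambda>k. xs k \<omega>" and w = "\<lambda>k. w k \<omega>"
          and \<phi> = "\<lambda>x. f x thstar" and G = "\<lambda>x. gradf x thstar" and r = ?r])
      show "compact X" using X(1) X_bdd by (simp add: compact_eq_bounded_closed)
      show "xs (Suc k) \<omega> = closest_point X (xs k \<omega> - \<gamma>x k *\<^sub>R (gradf (xs k \<omega>) thstar + ?r k + w k \<omega>))" for k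
        using x_step[OF elim(5)] by simp
      show "summable (\<lambda>k. \<gamma>x k * (b \<bullet> w k \<omega>))" if "b \<in> Basis" for b using elim(2) that by blast
    qed (rule X(2) xX[OF elim(5)] f_convex[OF thstar(1)] f_diff[OF thstar(1)] f_C1[OF thstar(1)]
        step_pos(1) div1 \<gamma>x2 r elim(1,3) | assumption)+
  qed
  moreover have "AE \<omega> in M. (\<lambda>k. ths k \<omega>) \<longlonglongrightarrow> thstar" using th_AE by eventually_elim blast
  ultimately show ?thesis by blast
qed

end
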